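(* Let $\chi \in \mathfrak{M}_{\infty}$. Then there exists a topologically invariant mean $\Phi$ on $L^{\infty}(\mathbb{R})$ such that $\Phi|_{H^{\infty}(\mathbb{C}^+)} = \chi$, i.e. such that for every $\phi \in H^{\infty}(\mathbb{C}^+)$ the value of $\Phi$ at the boundary function $y \mapsto \phi(iy)$ equals $\chi(\phi)$.
   Context: $\mathbb{C}^+ = \{z \in \mathbb{C} : \mathrm{Re}(z) > 0\}$ is the right half plane and $H^{\infty}(\mathbb{C}^+)$ is the Banach algebra (with the supremum norm) of bounded analytic functions on $\mathbb{C}^+$. Each $\phi \in H^{\infty}(\mathbb{C}^+)$ has nontangential boundary limits $\phi(iy) = \lim_{x \to 0^+} \phi(x+iy)$ for almost every $y \in \mathbb{R}$, and $\phi$ is identified with its boundary function $y \mapsto \phi(iy)$ in $L^{\infty}(\mathbb{R})$; thus $H^{\infty}(\mathbb{C}^+)$ is regarded as a subalgebra of $L^{\infty}(\mathbb{R})$. $\mathfrak{M}$ is the maximal ideal space of $H^{\infty}(\mathbb{C}^+)$, i.e. the set of complex homomorphisms of $H^{\infty}(\mathbb{C}^+)$ onto $\mathbb{C}$, with the weak* topology. For $z \in \mathbb{C}^+$, $\hat{z} \in \mathfrak{M}$ is the evaluation $\phi \mapsto \phi(z)$. $\mathfrak{M}_{\infty}$ is the set of $\chi \in \mathfrak{M}$ that are weak* limits of a net $\{\hat{z}_{\alpha}\}$ with $z_{\alpha} = x_{\alpha} + i y_{\alpha} \in \mathbb{C}^+$ and $\lim_{\alpha} x_{\alpha} = \infty$.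 Let $P(\mathbb{R})$ be the set of $f \in L^1(\mathbb{R})$ with $f \ge 0$ and $\int_{\mathbb{R}} f = 1$. A mean on $L^{\infty}(\mathbb{R})$ is an element $\Phi \in L^{\infty}(\mathbb{R})^*$ with $\Phi(\psi) \ge 0$ whenever $\psi \ge 0$ and $\Phi(1)=1$; it is topologically invariant if $\Phi(f * \psi) = \Phi(\psi)$ for every $f \in P(\mathbb{R})$ and $\psi \in L^{\infty}(\mathbb{R})$, where $(f*\psi)(x) = \int_{\mathbb{R}} \psi(x-t) f(t)\,dt$. *)

theory Defs
  imports "HOL-Complex_Analysis.Complex_Analysis" "HOL-Probability.Essential_Supremum"
begin

definition right_half_plane :: "complex set" where
  "right_half_plane = {z. Re z > 0}"

(* An element of the algebra is represented by its extension by 0 outside the half plane, so that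
   HOL equality is equality of functions on the half plane and the carrier is closed under the
   pointwise operations. *)
definition Hinf :: "(complex \<Rightarrow> complex) set" where
  "Hinf = {\<phi>. \<phi> holomorphic_on right_half_plane \<and> bounded (\<phi> ` right_half_plane) \<and>
               (\<forall>z. z \<notin> right_half_plane \<longrightarrow> \<phi> z = 0)}"

(* By Fatou's theorem the limit exists for almost every y; at the remaining y the value of Lim
   is irrelevant. *)
definition boundary_function :: "(complex \<Rightarrow> complex) \<Rightarrow> real \<Rightarrow> complex" where
  "boundary_function \<phi> = (\<lambda>y. Lim (at_right 0) (\<lambda>x. \<phi> (Complex x y)))"

definition maximal_ideal_space :: "((complex \<Rightarrow> complex) \<Rightarrow> complex) set" where
  "maximal_ideal_space = {\<theta>. \<theta> \<in> extensional Hinf \<and>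
     (\<forall>\<phi>\<in>Hinf. \<forall>\<psi>\<in>Hinf. \<theta> (\<lambda>z. \<phi> z + \<psi> z) = \<theta> \<phi> + \<theta> \<psi>) \<and>
     (\<forall>c. \<forall>\<phi>\<in>Hinf. \<theta> (\<lambda>z. c * \<phi> z) = c * \<theta> \<phi>) \<and>
     (\<forall>\<phi>\<in>Hinf. \<forall>\<psi>\<in>Hinf. \<theta> (\<lambda>z. \<phi> z * \<psi> z) = \<theta> \<phi> * \<theta> \<psi>) \<and>
     \<theta> ` Hinf = UNIV}"

definition weak_star_topology :: "((complex \<Rightarrow> complex) \<Rightarrow> complex) topology" where
  "weak_star_topology =
     subtopology (product_topology (\<lambda>_. euclidean) Hinf) maximal_ideal_space"

definition evaluation :: "complex \<Rightarrow> (complex \<Rightarrow> complex) \<Rightarrow> complex" where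
  "evaluation z = (\<lambda>\<phi>\<in>Hinf. \<phi> z)"

(* Nets in the half plane are rendered by proper filters: the image of the tail filter of a net is
   such a filter, and every proper filter arises from a net in this way. *)
definition maximal_ideals_at_infinity :: "((complex \<Rightarrow> complex) \<Rightarrow> complex) set" where
  "maximal_ideals_at_infinity = {\<theta> \<in> maximal_ideal_space. \<exists>F. F \<noteq> bot \<and>
     (\<forall>\<^sub>F z in F. z \<in> right_half_plane) \<and> filterlim Re at_top F \<and>
     limitin weak_star_topology evaluation \<theta> F}"

definition Linf_norm :: "(real \<Rightarrow> complex) \<Rightarrow> ereal" where
  "Linf_norm \<psi> = esssup lebesgue (\<lambda>y. ereal (norm (\<psi> y)))"

(* Representatives rather than classes modulo null sets. *)
definition Linf :: "(real \<Rightarrow> complex) set" where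
  "Linf = {\<psi>. \<psi> \<in> borel_measurable lebesgue \<and> Linf_norm \<psi> < \<infinity>}"

(* Linearity together with the norm bound makes such a functional take equal values on almost
   everywhere equal representatives; its values outside Linf are irrelevant. *)
definition Linf_dual :: "((real \<Rightarrow> complex) \<Rightarrow> complex) set" where
  "Linf_dual = {\<Phi>.
     (\<forall>\<psi>\<in>Linf. \<forall>\<eta>\<in>Linf. \<Phi> (\<lambda>y. \<psi> y + \<eta> y) = \<Phi> \<psi> + \<Phi> \<eta>) \<and>
     (\<forall>c. \<forall>\<psi>\<in>Linf. \<Phi> (\<lambda>y. c * \<psi> y) = c * \<Phi> \<psi>) \<and>
     (\<exists>K::real. \<forall>\<psi>\<in>Linf. norm (\<Phi> \<psi>) \<le> K * real_of_ereal (Linf_norm \<psi>))}"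

definition mean :: "((real \<Rightarrow> complex) \<Rightarrow> complex) \<Rightarrow> bool" where
  "mean \<Phi> \<longleftrightarrow> \<Phi> \<in> Linf_dual \<and>
     (\<forall>\<psi>\<in>Linf. (AE y in lebesgue. \<psi> y \<in> \<real>\<^sub>\<ge>\<^sub>0) \<longrightarrow> \<Phi> \<psi> \<in> \<real>\<^sub>\<ge>\<^sub>0) \<and>
     \<Phi> (\<lambda>_. 1) = 1"

definition probability_densities :: "(real \<Rightarrow> real) set" where
  "probability_densities = {f. integrable lebesgue f \<and> (AE t in lebesgue. 0 \<le> f t) \<and>
     (LINT t|lebesgue. f t) = 1}"

definition convolution :: "(real \<Rightarrow> real) \<Rightarrow> (real \<Rightarrow> complex) \<Rightarrow> real \<Rightarrow> complex" where
  "convolution f \<psi> = (\<lambda>x. LINT t|lebesgue. \<psi> (x - t) * of_real (f t))"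

definition topologically_invariant_mean :: "((real \<Rightarrow> complex) \<Rightarrow> complex) \<Rightarrow> bool" where
  "topologically_invariant_mean \<Phi> \<longleftrightarrow> mean \<Phi> \<and>
     (\<forall>f\<in>probability_densities. \<forall>\<psi>\<in>Linf. \<Phi> (convolution f \<psi>) = \<Phi> \<psi>)"

end

(* The mean is a limit of Poisson averages P_z psi along a filter refining the one that defines theta.
   As Re z tends to infinity the Poisson kernel becomes almost translation invariant in L^1, which
   gives topological invariance; and P_z applied to the boundary function of phi is phi(z), whose
   limit is theta(phi).

   The last identity rests on Fatou's theorem. For g = phi / (1 + z), the inner product of two
   vertical slices depends only on the sum of their abscissae (shift the line of integration), so the
   norm of the slices is midpoint convex and bounded, hence monotone, and the slices form a Cauchy net
   in L^2 at the boundary. A weak type estimate for the radial maximal function of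
   g(z) - g(z + d) upgrades this to almost everywhere convergence. *)
theory Submission
  imports Defs "HOL-Probability.Sinc_Integral"
begin

section \<open>The Poisson formula on the half plane\<close>

text \<open>Poisson averages of a general bounded function need not converge along the given filter,
  so a finer filter is taken to obtain a limit on all of L^infinity; on boundary functions the
  averages converge already, and refining the filter keeps their limits. Since
  \<open>boundary_function\<close> is a \<open>Lim\<close>, it can be integrated only once the
  radial limit is known to exist almost everywhere, and this is why Fatou's theorem takes up so much
  of the proof. L^2 convergence of the slices gives almost everywhere convergence only along a
  sequence of abscissae; letting x tend to 0 through all values requires control of a supremum over
  x, hence the maximal estimate. The Poisson formula is proved for functions analytic across the
  imaginary axis, so each use of it first shifts the function to the right.\<close>

definition poisson_kernel :: "real \<Rightarrow> real \<Rightarrow> real" where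
  "poisson_kernel x t = x / (pi * (x\<^sup>2 + t\<^sup>2))"

lemma poisson_kernel_nonneg: "x \<ge> 0 \<Longrightarrow> poisson_kernel x t \<ge> 0"
  by (simp add: poisson_kernel_def)

lemma poisson_kernel_measurable [measurable]: "poisson_kernel x \<in> borel_measurable borel"
  unfolding poisson_kernel_def by measurable

lemma poisson_kernel_has_integral:
  assumes "x > 0"
  shows "has_bochner_integral lborel (\<lambda>t. poisson_kernel x (y - t)) 1"
proof -
  have "has_bochner_integral lborel (\<lambda>t::real. inverse (1 + t\<^sup>2)) pi"
    using integrable_inverse_1_plus_square LBINT_inverse_1_plus_square
    by (simp add: interval_lebesgue_integral_def has_bochner_integral_iff set_integrable_def
        set_lebesgue_integral_def einterval_def)
  then have "has_bochner_integral lborel (\<lambda>t::real. inverse (1 + (y / x + (- 1 / x) * t)\<^sup>2)) (pi /\<^sub>R \<bar>- 1 / x\<bar>)"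
    using assms by (subst (asm) lborel_has_bochner_integral_real_affine_iff[where c = "- 1 / x" and t = "y / x"]) auto
  then have "has_bochner_integral lborel (\<lambda>t::real. inverse (1 + (y / x + (- 1 / x) * t)\<^sup>2) * (1 / (pi * x))) ((pi /\<^sub>R \<bar>- 1 / x\<bar>) * (1 / (pi * x)))"
    by (intro has_bochner_integral_mult_left)
  also have "(pi /\<^sub>R \<bar>- 1 / x\<bar>) * (1 / (pi * x)) = 1"
    using assms by (simp add: field_simps)
  also have "(\<lambda>t::real. inverse (1 + (y / x + (- 1 / x) * t)\<^sup>2) * (1 / (pi * x))) = (\<lambda>t. poisson_kernel x (y - t))"
  proof
    fix t
    have "y / x + (- 1 / x) * t = (y - t) / x"
      using assms by (simp add: field_simps)
    moreover have "x\<^sup>2 + (y - t)\<^sup>2 > 0"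
      using assms by (simp add: add_pos_nonneg)
    moreover have "1 + ((y - t) / x)\<^sup>2 = (x\<^sup>2 + (y - t)\<^sup>2) / x\<^sup>2"
      using assms by (simp add: field_simps)
    ultimately show "inverse (1 + (y / x + (- 1 / x) * t)\<^sup>2) * (1 / (pi * x)) = poisson_kernel x (y - t)"
      using assms unfolding poisson_kernel_def by (simp add: field_simps power2_eq_square)
  qed
  finally show ?thesis .
qed

lemma Complex_Re_Im_eq: "Complex u t = of_real u + \<i> * of_real t"
  by (simp add: complex_eq_iff)

lemma continuous_on_vertical_line:
  assumes "continuous_on S q" "\<And>t. t \<in> T \<Longrightarrow> Complex u t \<in> S"
  shows "continuous_on T (\<lambda>t. q (Complex u t))"
proof -
  have "continuous_on T (Complex u)"
    unfolding Complex_Re_Im_eq by (intro continuous_intros)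
  then show ?thesis
    using assms by (intro continuous_on_compose2[of S q T "Complex u"]) auto
qed

lemma integrable_inverse_1_plus_square_UNIV: "integrable lborel (\<lambda>t::real. 1 / (1 + t\<^sup>2))"
  using integrable_inverse_1_plus_square
  by (simp add: set_integrable_def einterval_def inverse_eq_divide)

text \<open>A primitive $Q$ of $q$ turns the two truncated integrals into increments of $Q$ along
  vertical segments, whose difference is controlled by $q$ on the horizontal sides.\<close>
lemma vertical_integral_shift:
  fixes q :: "complex \<Rightarrow> complex"
  assumes S: "convex S" "open S" and q: "q holomorphic_on S" and u: "u1 \<le> u2"
    and strip: "\<And>w. u1 \<le> Re w \<Longrightarrow> Re w \<le> u2 \<Longrightarrow> w \<in> S"
    and bound: "\<And>w. u1 \<le> Re w \<Longrightarrow> Re w \<le> u2 \<Longrightarrow> R \<le> \<bar>Im w\<bar> \<Longrightarrow> norm (q w) \<le> C / (Im w)\<^sup>2"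
  shows "(LINT t|lborel. q (Complex u1 t)) = (LINT t|lborel. q (Complex u2 t))"
proof -
  obtain Q where Q: "\<And>w. w \<in> S \<Longrightarrow> (Q has_field_derivative q w) (at w within S)"
    using holomorphic_convex_primitive'[OF S q] by blast
  have Q': "(Q has_field_derivative q w) (at w)" if "w \<in> S" for w
    using Q[OF that] unfolding at_within_open[OF that S(2)] .
  have contq: "continuous_on S q"
    using q by (rule holomorphic_on_imp_continuous_on)
  \<comment> \<open>The floor 1 makes (Im w)^2 at least 1 outside the rectangle \<open>D\<close>, so
    that |C| / (Im w)^2 is at most 2 |C| / (1 + (Im w)^2).\<close>
  define R' where "R' = max R 1"
  define D where "D = cbox (Complex u1 (- R')) (Complex u2 R')"
  have "D \<subseteq> S"
    unfolding D_def by (auto simp: in_cbox_complex_iff intro!: strip)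
  then have "compact (q ` D)"
    unfolding D_def by (intro compact_continuous_image continuous_on_subset[OF contq]) auto
  then obtain B where B: "\<forall>w\<in>D. norm (q w) \<le> B"
    by (auto dest!: compact_imp_bounded simp: bounded_iff)
  \<comment> \<open>One majorant for two regimes: compactness of \<open>D\<close> inside, the decay
    hypothesis outside. It is integrable on the whole line and uniform over the strip.\<close>
  define C' where "C' = max (2 * \<bar>C\<bar>) (\<bar>B\<bar> * (1 + R'\<^sup>2))"
  have C': "norm (q w) \<le> C' / (1 + (Im w)\<^sup>2)" if w: "u1 \<le> Re w" "Re w \<le> u2" for w
  proof (cases "\<bar>Im w\<bar> \<le> R'")
    case True
    then have "w \<in> D"
      using w unfolding D_def in_cbox_complex_iff by auto
    then have "norm (q w) \<le> \<bar>B\<bar>"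
      using B by fastforce
    moreover have "\<bar>B\<bar> * (1 + (Im w)\<^sup>2) \<le> \<bar>B\<bar> * (1 + R'\<^sup>2)"
      using True by (intro mult_left_mono add_left_mono) (auto simp: abs_le_square_iff[symmetric])
    ultimately have "norm (q w) * (1 + (Im w)\<^sup>2) \<le> C'"
      unfolding C'_def by (smt (verit) mult_right_mono zero_le_power2)
    then show ?thesis
      by (simp add: pos_le_divide_eq add_pos_nonneg)
  next
    case False
    then have im: "1 \<le> (Im w)\<^sup>2" "R \<le> \<bar>Im w\<bar>"
      unfolding R'_def using abs_le_square_iff[of 1 "Im w"] by auto
    have "norm (q w) \<le> \<bar>C\<bar> / (Im w)\<^sup>2"
      using bound[OF w im(2)] by (smt (verit) divide_right_mono zero_le_power2)
    then have "norm (q w) * (Im w)\<^sup>2 \<le> \<bar>C\<bar>"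
      by (subst (asm) pos_le_divide_eq) (use im(1) in linarith)+
    moreover have "norm (q w) * (1 + (Im w)\<^sup>2) \<le> 2 * (norm (q w) * (Im w)\<^sup>2)"
      using mult_left_mono[OF im(1) norm_ge_zero[of "q w"]] by (simp add: algebra_simps)
    ultimately have "norm (q w) * (1 + (Im w)\<^sup>2) \<le> C'"
      unfolding C'_def by linarith
    then show ?thesis
      by (simp add: pos_le_divide_eq add_pos_nonneg)
  qed
  \<comment> \<open>The factor -i compensates the derivative of t |-> Q(u + it), which is i q(u +
    it).\<close>
  have trunc: "(LINT t|lborel. indicator {- real n..real n} t *\<^sub>R q (Complex u t))
        = - \<i> * (Q (Complex u (real n)) - Q (Complex u (- real n)))"
    and lim: "(\<lambda>n. LINT t|lborel. indicator {- real n..real n} t *\<^sub>R q (Complex u t))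
        \<longlonglongrightarrow> (LINT t|lborel. q (Complex u t))"
    if u: "u1 \<le> u" "u \<le> u2" for u and n :: nat
  proof -
    have inS: "Complex u t \<in> S" for t
      using u by (intro strip) auto
    have cont: "continuous_on T (\<lambda>t. q (Complex u t))" for T
      using contq inS by (rule continuous_on_vertical_line)
    have der: "((\<lambda>t. - \<i> * Q (Complex u t)) has_vector_derivative q (Complex u t)) (at t within T)" for t T
    proof -
      have "(Complex u has_vector_derivative \<i>) (at t within T)"
        unfolding Complex_Re_Im_eq by (auto intro!: derivative_eq_intros)
      from field_vector_diff_chain_within[OF this has_field_derivative_at_within[OF Q'[OF inS]]]
      have "((Q \<circ> Complex u) has_vector_derivative \<i> * q (Complex u t)) (at t within T)" .
      then have "((\<lambda>t. - \<i> * (Q \<circ> Complex u) t) has_vector_derivative - \<i> * (\<i> * q (Complex u t))) (at t within T)"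
        by (rule has_vector_derivative_mult_right)
      then show ?thesis
        by (simp add: o_def flip: mult.assoc)
    qed
    show "(LINT t|lborel. indicator {- real n..real n} t *\<^sub>R q (Complex u t))
        = - \<i> * (Q (Complex u (real n)) - Q (Complex u (- real n)))"
      by (subst integral_FTC_atLeastAtMost[OF _ der cont]) (auto simp: algebra_simps)
    show "(\<lambda>n. LINT t|lborel. indicator {- real n..real n} t *\<^sub>R q (Complex u t))
        \<longlonglongrightarrow> (LINT t|lborel. q (Complex u t))"
    proof (rule integral_dominated_convergence[where w = "\<lambda>t. C' * (1 / (1 + t\<^sup>2))"])
      show "(\<lambda>t. q (Complex u t)) \<in> borel_measurable lborel"
        using borel_measurable_continuous_onI[OF cont] by simp
      then show "(\<lambda>t. indicator {- real n..real n} t *\<^sub>R q (Complex u t)) \<in> borel_measurable lborel" for n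
        by simp
      show "integrable lborel (\<lambda>t. C' * (1 / (1 + t\<^sup>2)))"
        by (intro integrable_mult_right integrable_inverse_1_plus_square_UNIV)
      show "AE t in lborel. (\<lambda>n. indicator {- real n..real n} t *\<^sub>R q (Complex u t)) \<longlonglongrightarrow> q (Complex u t)"
      proof (intro AE_I2 tendsto_eventually)
        fix t :: real
        obtain N where N: "\<bar>t\<bar> \<le> real N"
          using real_arch_simple by blast
        have "t \<in> {- real n..real n}" if "n \<ge> N" for n
          using N that by auto
        then show "\<forall>\<^sub>F n in sequentially. indicator {- real n..real n} t *\<^sub>R q (Complex u t) = q (Complex u t)"
          unfolding eventually_sequentially by (intro exI[of _ N]) (auto simp: indicator_def)
      qed
      show "AE t in lborel. norm (indicator {- real n..real n} t *\<^sub>R q (Complex u t)) \<le> C' * (1 / (1 + t\<^sup>2))" for n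
      proof (intro AE_I2)
        fix t :: real
        have "norm (indicator {- real n..real n} t *\<^sub>R q (Complex u t)) \<le> norm (q (Complex u t))"
          by (simp add: indicator_def)
        also have "\<dots> \<le> C' * (1 / (1 + t\<^sup>2))"
          using C'[of "Complex u t"] u by simp
        finally show "norm (indicator {- real n..real n} t *\<^sub>R q (Complex u t)) \<le> C' * (1 / (1 + t\<^sup>2))" .
      qed
    qed
  qed
  have side: "norm (Q (Complex u2 s) - Q (Complex u1 s)) \<le> C' / (1 + s\<^sup>2) * (u2 - u1)" for s
  proof -
    have "norm (Q (Complex u2 s) - Q (Complex u1 s)) \<le> C' / (1 + s\<^sup>2) * norm (Complex u2 s - Complex u1 s)"
    proof (rule field_differentiable_bound[where f' = q])
      \<comment> \<open>This box is degenerate: it is the horizontal segment from u1 + is to u2 +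
        is.\<close>
      show "convex (cbox (Complex u1 s) (Complex u2 s))"
        by (rule convex_box)
      show "(Q has_field_derivative q z) (at z within (cbox (Complex u1 s) (Complex u2 s)))"
        if "z \<in> (cbox (Complex u1 s) (Complex u2 s))" for z
      proof (rule has_field_derivative_at_within, rule Q', rule strip)
        show "u1 \<le> Re z" "Re z \<le> u2"
          using that by (auto simp: in_cbox_complex_iff)
      qed
    qed (use u C' in \<open>auto simp: in_cbox_complex_iff\<close>)
    also have "norm (Complex u2 s - Complex u1 s) = u2 - u1"
      using u by (simp add: cmod_def)
    finally show ?thesis .
  qed
  have "(\<lambda>n. C' / (1 + (real n)\<^sup>2) * (u2 - u1)) \<longlonglongrightarrow> 0"
    by real_asymp
  then have lim0: "(\<lambda>n. 2 * (C' / (1 + (real n)\<^sup>2) * (u2 - u1))) \<longlonglongrightarrow> 0"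
    using tendsto_mult_right_zero by blast
  have "(\<lambda>n. (LINT t|lborel. indicator {- real n..real n} t *\<^sub>R q (Complex u2 t))
        - (LINT t|lborel. indicator {- real n..real n} t *\<^sub>R q (Complex u1 t))) \<longlonglongrightarrow> 0"
  proof (rule Lim_null_comparison[OF _ lim0], intro always_eventually allI)
    fix n
    have "norm ((LINT t|lborel. indicator {- real n..real n} t *\<^sub>R q (Complex u2 t))
        - (LINT t|lborel. indicator {- real n..real n} t *\<^sub>R q (Complex u1 t)))
      = norm (- \<i> * ((Q (Complex u2 (real n)) - Q (Complex u1 (real n))) - (Q (Complex u2 (- real n)) - Q (Complex u1 (- real n)))))"
      using u by (simp add: trunc algebra_simps)
    also have "\<dots> = norm ((Q (Complex u2 (real n)) - Q (Complex u1 (real n))) - (Q (Complex u2 (- real n)) - Q (Complex u1 (- real n))))"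
      by (simp add: norm_mult)
    also have "\<dots> \<le> norm (Q (Complex u2 (real n)) - Q (Complex u1 (real n))) + norm (Q (Complex u2 (- real n)) - Q (Complex u1 (- real n)))"
      by (rule norm_triangle_ineq4)
    also have "\<dots> \<le> 2 * (C' / (1 + (real n)\<^sup>2) * (u2 - u1))"
      using side[of "real n"] side[of "- real n"] by simp
    finally show "norm ((LINT t|lborel. indicator {- real n..real n} t *\<^sub>R q (Complex u2 t))
        - (LINT t|lborel. indicator {- real n..real n} t *\<^sub>R q (Complex u1 t)))
      \<le> 2 * (C' / (1 + (real n)\<^sup>2) * (u2 - u1))" .
  qed
  moreover have "(\<lambda>n. (LINT t|lborel. indicator {- real n..real n} t *\<^sub>R q (Complex u2 t))
        - (LINT t|lborel. indicator {- real n..real n} t *\<^sub>R q (Complex u1 t)))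
      \<longlonglongrightarrow> (LINT t|lborel. q (Complex u2 t)) - (LINT t|lborel. q (Complex u1 t))"
    using u by (intro tendsto_diff lim) auto
  ultimately show ?thesis
    using LIMSEQ_unique by fastforce
qed

text \<open>The kernel has mass 1. If h is not integrable, its integral is 0 by default and only K
  >= 0 has to be shown, which follows from the bound at a single point because the kernel is
  positive there.\<close>

lemma norm_integral_le_poisson:
  assumes x: "x > 0" and h: "\<And>t. norm (h t) \<le> K * poisson_kernel x (y - t)"
  shows "norm (LINT t|lborel. (h t :: complex)) \<le> K"
proof (cases "integrable lborel h")
  case True
  note p = poisson_kernel_has_integral[OF x, of y]
  have "norm (LINT t|lborel. h t) \<le> (LINT t|lborel. norm (h t))"
    by (rule integral_norm_bound)
  also have "\<dots> \<le> (LINT t|lborel. K * poisson_kernel x (y - t))"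
    using p True h by (intro integral_mono integrable_norm integrable_mult_right) (auto simp: has_bochner_integral_iff)
  also have "\<dots> = K"
    using p by (simp add: has_bochner_integral_iff)
  finally show ?thesis .
next
  case False
  have "0 \<le> K * poisson_kernel x (y - 0)"
    using h[of 0] norm_ge_zero order_trans by blast
  moreover have "poisson_kernel x (y - 0) > 0"
    using x by (simp add: poisson_kernel_def add_pos_nonneg)
  ultimately have "K \<ge> 0"
    by (simp add: zero_le_mult_iff)
  then show ?thesis
    using False by (simp add: not_integrable_integral_eq)
qed

text \<open>The pole -cnj z is the mirror image of z in the imaginary axis, so it is at least as far
  from w as z is. On the line Re w = Re z + v, the left side is the denominator of a Poisson kernel
  of width v.\<close>

lemma norm_mult_linear_factors_ge:
  assumes "0 < Re z" "Re z < Re w"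
  shows "(Re w - Re z)\<^sup>2 + (Im w - Im z)\<^sup>2 \<le> norm (w - z) * norm (w + cnj z)"
proof -
  define m where "m = sqrt ((Re w - Re z)\<^sup>2 + (Im w - Im z)\<^sup>2)"
  have "norm (w - z) = m" "m \<ge> 0"
    by (simp_all add: m_def cmod_def)
  moreover have "m \<le> norm (w + cnj z)"
    unfolding m_def cmod_def using assms by (auto intro!: add_mono power_mono)
  ultimately have "m * m \<le> norm (w - z) * norm (w + cnj z)"
    by (simp add: mult_left_mono)
  then show ?thesis
    by (simp add: m_def)
qed

text \<open>With $z = x + iy$, one has $(it - z)(it + \bar z) = -(x^2 + (y - t)^2)$; removing the pole of
  $f(w) / ((w - z)(w + \bar z))$ at $z$ leaves a function whose vertical integrals vanish, since
  they are constant and tend to $0$ at infinity.\<close>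
lemma poisson_formula:
  assumes hol: "f holomorphic_on {w. Re w > - d}" and d: "d > 0"
    and M: "\<And>w. Re w > - d \<Longrightarrow> norm (f w) \<le> M" and z: "Re z > 0"
  shows "(LINT t|lborel. poisson_kernel (Re z) (Im z - t) *\<^sub>R f (Complex 0 t)) = f z"
proof -
  \<comment> \<open>With e <= Re z the second pole -cnj z stays outside \<open>S\<close>; with e <=
    d the function f is analytic on \<open>S\<close>.\<close>
  define e where "e = min d (Re z)"
  define S where "S = {w. Re w > - e}"
  define \<psi> where "\<psi> = (\<lambda>w. if w = z then deriv f z else (f w - f z) / (w - z))"
  define q where "q = (\<lambda>w. \<psi> w / (w + cnj z))"
  have S: "open S" "convex S"
    unfolding S_def by (simp_all add: open_halfspace_Re_gt convex_halfspace_Re_gt)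
  have Sd: "S \<subseteq> {w. Re w > - d}"
    unfolding S_def e_def by auto
  have nz: "w + cnj z \<noteq> 0" if "w \<in> S" for w
  proof
    assume "w + cnj z = 0"
    then have "Re w = - Re z"
      by (simp add: complex_eq_iff)
    then show False
      using that unfolding S_def e_def by auto
  qed
  have "\<psi> holomorphic_on S"
    unfolding \<psi>_def by (rule pole_lemma_open[OF holomorphic_on_subset[OF hol Sd] S(1)])
  then have q: "q holomorphic_on S"
    unfolding q_def using nz by (intro holomorphic_intros) auto
  have fz: "norm (f w - f z) \<le> 2 * M" if "w \<in> S" for w
    using norm_triangle_ineq4[of "f w" "f z"] M[of w] M[of z] that Sd z d by auto
  have M0: "M \<ge> 0"
    using M[of z] z d norm_ge_zero[of "f z"] by linarith
  have qbound: "norm (q w) \<le> 2 * M / (norm (w - z) * norm (w + cnj z))" if "w \<in> S" "w \<noteq> z" for w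
    using fz[OF that(1)] that(2)
    by (simp add: q_def \<psi>_def norm_divide norm_mult divide_right_mono)
  \<comment> \<open>When |Im w| >= 2 |Im z| + 1, both linear factors are at least |Im w| / 2, which
    turns 2 M into 8 M.\<close>
  have shift: "(LINT t|lborel. q (Complex 0 t)) = (LINT t|lborel. q (Complex u t))" if u: "u > 0" for u
  proof (rule vertical_integral_shift[OF S(2,1) q, where R = "2 * \<bar>Im z\<bar> + 1" and C = "8 * M"])
    fix w assume w: "0 \<le> Re w" "Re w \<le> u"
    show wS: "w \<in> S"
      using w d z by (auto simp: S_def e_def)
    assume R: "2 * \<bar>Im z\<bar> + 1 \<le> \<bar>Im w\<bar>"
    have 1: "\<bar>Im w\<bar> / 2 \<le> norm (w - z)" "\<bar>Im w\<bar> / 2 \<le> norm (w + cnj z)"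
      using R abs_Im_le_cmod[of "w - z"] abs_Im_le_cmod[of "w + cnj z"] by auto
    have "w \<noteq> z"
      using R by auto
    have "norm (q w) \<le> 2 * M / (norm (w - z) * norm (w + cnj z))"
      by (rule qbound[OF wS \<open>w \<noteq> z\<close>])
    also have "\<dots> \<le> 2 * M / ((\<bar>Im w\<bar> / 2) * (\<bar>Im w\<bar> / 2))"
      using 1 R M0 by (intro divide_left_mono mult_mono mult_pos_pos) auto
    also have "\<dots> = 8 * M / (Im w)\<^sup>2"
      by (simp add: power2_eq_square field_simps)
    finally show "norm (q w) \<le> 8 * M / (Im w)\<^sup>2" .
  qed (use u in auto)
  \<comment> \<open>On the line Re w = Re z + v the bound for q is a multiple of the kernel of width
    v, so the integral is O(1 / v). By \<open>shift\<close> the same bound holds on the imaginary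
    axis, for every v.\<close>
  have small: "norm (LINT t|lborel. q (Complex 0 t)) \<le> 2 * M * pi / v" if v: "v > 0" for v
  proof -
    have "norm (LINT t|lborel. q (Complex (Re z + v) t)) \<le> 2 * M * pi / v"
    proof (rule norm_integral_le_poisson[OF v, where y = "Im z"])
      fix t
      define w where "w = Complex (Re z + v) t"
      have "w \<in> S" "w \<noteq> z" "Re z < Re w"
        using z d v by (auto simp: w_def S_def e_def complex_eq_iff)
      then have "norm (q w) \<le> 2 * M / (norm (w - z) * norm (w + cnj z))"
        by (intro qbound)
      also have "\<dots> \<le> 2 * M / (v\<^sup>2 + (t - Im z)\<^sup>2)"
      proof (intro divide_left_mono)
        show "v\<^sup>2 + (t - Im z)\<^sup>2 \<le> norm (w - z) * norm (w + cnj z)"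
          using norm_mult_linear_factors_ge[OF z \<open>Re z < Re w\<close>] by (simp add: w_def)
        then show "0 < norm (w - z) * norm (w + cnj z) * (v\<^sup>2 + (t - Im z)\<^sup>2)"
          using v by (smt (verit) add_pos_nonneg mult_pos_pos zero_le_power2 zero_less_power)
      qed (use M0 in auto)
      also have "\<dots> = 2 * M * pi / v * poisson_kernel v (Im z - t)"
        using v by (simp add: poisson_kernel_def power2_commute)
      finally show "norm (q (Complex (Re z + v) t)) \<le> 2 * M * pi / v * poisson_kernel v (Im z - t)"
        by (simp add: w_def)
    qed
    then show ?thesis
      using shift[of "Re z + v"] z v by simp
  qed
  have "((\<lambda>v. 2 * M * pi / v) \<longlongrightarrow> 0) at_top"
    by real_asymp
  then have "norm (LINT t|lborel. q (Complex 0 t)) \<le> 0"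
    by (rule tendsto_lowerbound) (auto intro!: eventually_at_top_linorderI[of 1] small)
  then have q0: "(LINT t|lborel. q (Complex 0 t)) = 0"
    by simp
  let ?p = "\<lambda>t. poisson_kernel (Re z) (Im z - t)"
  have p: "integrable lborel ?p" "integral\<^sup>L lborel ?p = 1"
    using poisson_kernel_has_integral[OF z, of "Im z"] by (auto simp: has_bochner_integral_iff)
  have decomp: "?p t *\<^sub>R f (Complex 0 t) = ?p t *\<^sub>R f z - of_real (Re z / pi) * q (Complex 0 t)" for t
  proof -
    define w where "w = Complex 0 t"
    have ne: "w - z \<noteq> 0" "w + cnj z \<noteq> 0"
      using z by (auto simp: w_def complex_eq_iff)
    define m where "m = (Re z)\<^sup>2 + (Im z - t)\<^sup>2"
    have pos: "m > 0"
      unfolding m_def using z by (simp add: add_pos_nonneg)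
    have prod: "(w - z) * (w + cnj z) = - of_real m"
      by (simp add: m_def w_def complex_eq_iff power2_eq_square algebra_simps)
    have "q w = (f w - f z) / ((w - z) * (w + cnj z))"
      using ne by (simp add: q_def \<psi>_def)
    also have "\<dots> = - (f w - f z) / of_real m"
      unfolding prod by (simp only: divide_minus_right minus_divide_left)
    finally have qw: "q w = (f z - f w) / of_real m"
      by simp
    have "?p t = Re z / (pi * m)"
      by (simp add: poisson_kernel_def m_def)
    then have "of_real (Re z / pi) * q w = of_real (?p t) * (f z - f w)"
      unfolding qw by simp
    then show ?thesis
      by (simp add: w_def scaleR_conv_of_real algebra_simps)
  qed
  have cont: "continuous_on UNIV (\<lambda>t. f (Complex 0 t))"
    by (rule continuous_on_vertical_line[OF holomorphic_on_imp_continuous_on[OF hol]]) (use d in auto)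
  have meas: "(\<lambda>t. ?p t *\<^sub>R f (Complex 0 t)) \<in> borel_measurable lborel"
    using borel_measurable_continuous_onI[OF cont] by simp
  have int1: "integrable lborel (\<lambda>t. ?p t *\<^sub>R f (Complex 0 t))"
  proof (rule Bochner_Integration.integrable_bound[OF integrable_mult_right[OF p(1), of M] meas])
    show "AE t in lborel. norm (?p t *\<^sub>R f (Complex 0 t)) \<le> norm (M * ?p t)"
    proof (intro AE_I2)
      fix t
      have "norm (f (Complex 0 t)) \<le> M"
        using d by (intro M) simp
      then show "norm (?p t *\<^sub>R f (Complex 0 t)) \<le> norm (M * ?p t)"
        using M0 poisson_kernel_nonneg[of "Re z" "Im z - t"] z
        by (simp add: abs_mult mult.commute[of M] mult_left_mono)
    qed
  qed
  have int2: "integrable lborel (\<lambda>t. ?p t *\<^sub>R f z)"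
    using p(1) by simp
  have "integrable lborel (\<lambda>t. of_real (Re z / pi) * q (Complex 0 t))"
    using Bochner_Integration.integrable_diff[OF int2 int1] by (simp add: decomp)
  then have "(LINT t|lborel. ?p t *\<^sub>R f (Complex 0 t))
      = (LINT t|lborel. ?p t *\<^sub>R f z) - (LINT t|lborel. of_real (Re z / pi) * q (Complex 0 t))"
    unfolding decomp by (intro Bochner_Integration.integral_diff int2)
  also have "\<dots> = f z"
    using p q0 by simp
  finally show ?thesis .
qed

section \<open>Weak type maximal estimates\<close>

text \<open>The kernel is dominated by a superposition of indicators of the dyadic intervals
  $[-2^k x, 2^k x]$.\<close>
lemma poisson_kernel_dyadic_bound:
  assumes x: "x > 0"
  obtains k where "\<bar>t\<bar> \<le> 2 ^ k * x" "poisson_kernel x t \<le> 4 / (pi * x) * (1 / 4) ^ k"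
proof -
  \<comment> \<open>Minimality gives |t| > 2^(k - 1) x when k > 0, so the denominator is at least
    4^(k - 1) x^2; the 4 in the constant absorbs the shift of the exponent.\<close>
  define k where "k = (LEAST k. \<bar>t\<bar> \<le> 2 ^ k * x)"
  have "\<exists>k. \<bar>t\<bar> \<le> 2 ^ k * x"
  proof -
    obtain n where "\<bar>t\<bar> / x < 2 ^ n"
      using real_arch_pow[of 2 "\<bar>t\<bar> / x"] by auto
    then show ?thesis
      using x by (intro exI[of _ n]) (simp add: field_simps)
  qed
  then have k: "\<bar>t\<bar> \<le> 2 ^ k * x"
    unfolding k_def by (rule LeastI_ex)
  have "poisson_kernel x t \<le> 4 / (pi * x) * (1 / 4) ^ k"
  proof (cases k)
    case 0
    have "x / (pi * (x\<^sup>2 + t\<^sup>2)) \<le> x / (pi * x\<^sup>2)"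
      using x by (intro divide_left_mono mult_left_mono mult_pos_pos) (auto simp: add_pos_nonneg)
    also have "\<dots> = 1 / (pi * x)"
      using x by (simp add: power2_eq_square)
    also have "\<dots> \<le> 4 / (pi * x)"
      using x by (intro divide_right_mono) auto
    finally show ?thesis
      using 0 by (simp add: poisson_kernel_def)
  next
    case (Suc j)
    have "\<not> \<bar>t\<bar> \<le> 2 ^ j * x"
      using not_less_Least[of j "\<lambda>k. \<bar>t\<bar> \<le> 2 ^ k * x"] Suc unfolding k_def by simp
    then have "(2 ^ j * x)\<^sup>2 \<le> \<bar>t\<bar>\<^sup>2"
      using x by (intro power_mono) auto
    moreover have "(2 ^ j)\<^sup>2 = (4 :: real) ^ j"
      by (simp add: power2_eq_square flip: power_mult_distrib)
    ultimately have "4 ^ j * x\<^sup>2 \<le> t\<^sup>2"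
      by (simp add: power_mult_distrib)
    then have t: "4 ^ j * x\<^sup>2 \<le> x\<^sup>2 + t\<^sup>2"
      using zero_le_power2[of x] by linarith
    have "x / (pi * (x\<^sup>2 + t\<^sup>2)) \<le> x / (pi * (4 ^ j * x\<^sup>2))"
      using x t by (intro divide_left_mono mult_left_mono mult_pos_pos) (auto simp: add_pos_nonneg)
    also have "\<dots> = 4 / (pi * x) * (1 / 4) ^ k"
      using x Suc by (simp add: power2_eq_square field_simps)
    finally show ?thesis
      by (simp add: poisson_kernel_def)
  qed
  with k show ?thesis
    by (rule that)
qed

text \<open>Poisson averages are controlled by the Hardy-Littlewood maximal function. The dyadic
  weights decay like 4^(-k) while the masses of the intervals grow at most like 2^k, and 4 m / pi
  times the geometric series of ratio 1/2 gives 8 m / pi.\<close>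

lemma poisson_integral_le_of_interval_bound:
  fixes h :: "real \<Rightarrow> real"
  assumes [measurable]: "h \<in> borel_measurable borel" and h: "\<And>t. h t \<ge> 0" and x: "x > 0"
    and m: "m \<ge> 0"
    and bound: "\<And>r. r > 0 \<Longrightarrow> (\<integral>\<^sup>+t. ennreal (h t) * indicator (cball y r) t \<partial>lborel) \<le> ennreal (m * r)"
  shows "(\<integral>\<^sup>+t. ennreal (poisson_kernel x (y - t) * h t) \<partial>lborel) \<le> ennreal (8 * m / pi)"
proof -
  have meas: "(\<lambda>t. ennreal (h t) * indicator (cball y r) t) \<in> borel_measurable lborel" for r
    by (intro borel_measurable_times_ennreal borel_measurable_indicator) auto
  define c where "c k = 4 / (pi * x) * (1 / 4) ^ k" for k :: nat
  have c: "c k \<ge> 0" for k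
    using x by (simp add: c_def)
  have "(\<integral>\<^sup>+t. ennreal (poisson_kernel x (y - t) * h t) \<partial>lborel)
      \<le> (\<integral>\<^sup>+t. (\<Sum>k. ennreal (c k) * (ennreal (h t) * indicator (cball y (2 ^ k * x)) t)) \<partial>lborel)"
  proof (intro nn_integral_mono)
    fix t
    obtain k where k: "\<bar>y - t\<bar> \<le> 2 ^ k * x" "poisson_kernel x (y - t) \<le> c k"
      using poisson_kernel_dyadic_bound[OF x, of "y - t"] unfolding c_def by blast
    have "ennreal (poisson_kernel x (y - t) * h t) \<le> ennreal (c k * h t)"
      using k h by (intro ennreal_leI mult_right_mono)
    also have "\<dots> = (\<Sum>k\<in>{k}. ennreal (c k) * (ennreal (h t) * indicator (cball y (2 ^ k * x)) t))"
      using k(1) h[of t] c[of k] by (simp add: ennreal_mult dist_real_def)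
    also have "\<dots> \<le> (\<Sum>k. ennreal (c k) * (ennreal (h t) * indicator (cball y (2 ^ k * x)) t))"
      by (intro sum_le_suminf) (auto intro: summableI)
    finally show "ennreal (poisson_kernel x (y - t) * h t) \<le> \<dots>" .
  qed
  also have "\<dots> = (\<Sum>k. ennreal (c k) * (\<integral>\<^sup>+t. ennreal (h t) * indicator (cball y (2 ^ k * x)) t \<partial>lborel))"
    by (subst nn_integral_suminf) (intro borel_measurable_times_ennreal meas, simp_all add: nn_integral_cmult[OF meas])
  also have "\<dots> \<le> (\<Sum>k. ennreal (c k * (m * (2 ^ k * x))))"
  proof (intro suminf_le summableI)
    fix k
    have "ennreal (c k) * (\<integral>\<^sup>+t. ennreal (h t) * indicator (cball y (2 ^ k * x)) t \<partial>lborel)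
        \<le> ennreal (c k) * ennreal (m * (2 ^ k * x))"
      using x by (intro mult_left_mono bound) auto
    also have "\<dots> = ennreal (c k * (m * (2 ^ k * x)))"
      by (rule ennreal_mult''[symmetric]) (use m x in auto)
    finally show "ennreal (c k) * (\<integral>\<^sup>+t. ennreal (h t) * indicator (cball y (2 ^ k * x)) t \<partial>lborel)
        \<le> ennreal (c k * (m * (2 ^ k * x)))" .
  qed
  also have "(\<lambda>k. c k * (m * (2 ^ k * x))) = (\<lambda>k. 4 * m / pi * (1 / 2) ^ k)"
  proof
    fix k
    have "(1 / 4) ^ k * 2 ^ k = (1 / 2 :: real) ^ k"
      by (simp flip: power_mult_distrib)
    then show "c k * (m * (2 ^ k * x)) = 4 * m / pi * (1 / 2) ^ k"
      using x by (simp add: c_def field_simps)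
  qed
  also have "(\<Sum>k. ennreal (4 * m / pi * (1 / 2) ^ k)) = ennreal (4 * m / pi * 2)"
  proof (rule suminf_ennreal_eq)
    show "(\<lambda>k. 4 * m / pi * (1 / 2) ^ k) sums (4 * m / pi * 2)"
      using geometric_sums[of "1 / 2 :: real"] by (intro sums_mult) simp
  qed (use m in auto)
  finally show ?thesis
    by simp
qed

text \<open>Vitali covering argument: select disjoint intervals whose five-fold enlargements cover
  E. Each enlargement has length 10 r, which is less than 10 / m times the mass of h on the original
  interval, and the masses of disjoint intervals add up to at most I.\<close>

lemma maximal_weak_type:
  fixes h :: "real \<Rightarrow> real"
  assumes [measurable]: "h \<in> borel_measurable borel" "E \<in> sets borel" and m: "m > 0"
    and I: "(\<integral>\<^sup>+t. ennreal (h t) \<partial>lborel) \<le> ennreal I"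
    and E: "\<And>y. y \<in> E \<Longrightarrow> \<exists>r>0. ennreal (m * r) < (\<integral>\<^sup>+t. ennreal (h t) * indicator (cball y r) t \<partial>lborel)"
  shows "emeasure lborel E \<le> ennreal (10 * I / m)"
proof -
  define N where "N = density lborel (\<lambda>t. ennreal (h t))"
  have [simp]: "sets N = sets borel"
    by (simp add: N_def)
  have N: "emeasure N A = (\<integral>\<^sup>+t. ennreal (h t) * indicator A t \<partial>lborel)" if "A \<in> sets borel" for A
    using that unfolding N_def by (subst emeasure_density) auto
  have NI: "emeasure N A \<le> ennreal I" if "A \<in> sets borel" for A
    unfolding N[OF that] by (rule order_trans[OF nn_integral_mono I]) (simp add: indicator_def)
  obtain r where r: "\<And>y. y \<in> E \<Longrightarrow> r y > 0" "\<And>y. y \<in> E \<Longrightarrow> ennreal (m * r y) < emeasure N (cball y (r y))"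
    using E by (simp add: N) metis
  \<comment> \<open>The covering lemma requires bounded radii; the bound comes from the total mass
    I.\<close>
  have rB: "r y \<le> I / m" if "y \<in> E" for y
  proof -
    have "ennreal (m * r y) < ennreal I"
      using r(2)[OF that] NI[of "cball y (r y)"] by (rule less_le_trans) simp
    then have "m * r y \<le> I"
      using ennreal_less_iff[of "m * r y" I] r(1)[OF that] m by simp
    then show ?thesis
      using m by (simp add: field_simps)
  qed
  have "E \<subseteq> (\<Union>y\<in>E. cball y (r y))"
    using r(1) by force
  then obtain C where C: "countable C" "C \<subseteq> E"
      and disj: "pairwise (\<lambda>i j. disjnt (cball i (r i)) (cball j (r j))) C"
      and cov: "E \<subseteq> (\<Union>i\<in>C. cball i (5 * r i))"
    by (rule Vitali_covering_lemma_cballs[where S = E and K = E and a = "\<lambda>y. y" and r = r and B = "I / m"])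
      (use r(1) rB that in blast)+
  have "emeasure lborel E = (\<integral>\<^sup>+t. indicator E t \<partial>lborel)"
    by simp
  \<comment> \<open>Integration over \<open>count_space C\<close> serves as the sum over the
    countable family, so that C need not be enumerated.\<close>
  also have "\<dots> \<le> (\<integral>\<^sup>+t. (\<integral>\<^sup>+i. indicator (cball i (5 * r i)) t \<partial>count_space C) \<partial>lborel)"
  proof (intro nn_integral_mono)
    fix t
    show "indicator E t \<le> (\<integral>\<^sup>+i. indicator (cball i (5 * r i)) t \<partial>count_space C)"
    proof (cases "t \<in> E")
      case True
      then obtain i where i: "i \<in> C" "t \<in> cball i (5 * r i)"
        using cov by blast
      then have "indicator E t \<le> (indicator (cball i (5 * r i)) t :: ennreal)"
        by (simp add: indicator_def)
      also have "\<dots> \<le> (\<integral>\<^sup>+i. indicator (cball i (5 * r i)) t \<partial>count_space C)"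
        using i(1) by (rule nn_integral_ge_point)
      finally show ?thesis .
    qed simp
  qed
  also have "\<dots> = (\<integral>\<^sup>+i. (\<integral>\<^sup>+t. indicator (cball i (5 * r i)) t \<partial>lborel) \<partial>count_space C)"
    using C(1) by (rule nn_integral_count_space_nn_integral) (auto intro!: borel_measurable_indicator)
  also have "\<dots> \<le> (\<integral>\<^sup>+i. ennreal (10 / m) * emeasure N (cball i (r i)) \<partial>count_space C)"
  proof (intro nn_integral_mono)
    fix i assume "i \<in> space (count_space C)"
    then have i: "i \<in> E"
      using C(2) by auto
    have "(\<integral>\<^sup>+t. indicator (cball i (5 * r i)) t \<partial>lborel) = ennreal (10 * r i)"
      using r(1)[OF i] by (simp add: cball_eq_atLeastAtMost)
    also have "\<dots> = ennreal (10 / m) * ennreal (m * r i)"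
      using m r(1)[OF i] by (simp flip: ennreal_mult)
    also have "\<dots> \<le> ennreal (10 / m) * emeasure N (cball i (r i))"
      using r(2)[OF i] by (intro mult_left_mono) auto
    finally show "(\<integral>\<^sup>+t. indicator (cball i (5 * r i)) t \<partial>lborel) \<le> ennreal (10 / m) * emeasure N (cball i (r i))" .
  qed
  also have "\<dots> = ennreal (10 / m) * (\<integral>\<^sup>+i. emeasure N (cball i (r i)) \<partial>count_space C)"
    by (rule nn_integral_cmult) simp
  also have "(\<integral>\<^sup>+i. emeasure N (cball i (r i)) \<partial>count_space C) = emeasure N (\<Union>i\<in>C. cball i (r i))"
    using C(1) disj
    by (intro emeasure_UN_countable[symmetric]) (auto simp: disjoint_family_on_def pairwise_def disjnt_def)
  also have "\<dots> \<le> ennreal I"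
    using C(1) by (intro NI) auto
  also have "ennreal (10 / m) * ennreal I = ennreal (10 * I / m)"
    using m by (simp flip: ennreal_mult')
  finally show ?thesis
    by (simp add: mult_left_mono)
qed

text \<open>Supplies measurability of the superlevel sets of the radial maximal function: openness
  survives the uncountable union over x.\<close>

lemma open_vertical_translates_large:
  assumes "continuous_on {w. Re w > 0} f" "a \<ge> 0"
  shows "open {y. \<exists>x>a. norm (f (Complex x y)) > c}"
proof -
  have "open {y. norm (f (Complex x y)) > c}" if "x > a" for x
  proof -
    have "continuous_on UNIV (\<lambda>y. f (Complex x y))"
      using assms that by (intro continuous_on_vertical_line[of "{w. Re w > 0}"]) auto
    then have "continuous_on UNIV (\<lambda>y. norm (f (Complex x y)))"
      by (rule continuous_on_norm)
    then show ?thesis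
      using open_Collect_less[of "\<lambda>_. c"] continuous_on_const by blast
  qed
  then have "open (\<Union>x\<in>{a<..}. {y. norm (f (Complex x y)) > c})"
    by blast
  moreover have "{y. \<exists>x>a. norm (f (Complex x y)) > c} = (\<Union>x\<in>{a<..}. {y. norm (f (Complex x y)) > c})"
    by auto
  ultimately show ?thesis
    by simp
qed

text \<open>Beyond abscissa \<open>\<eta>\<close>, k is the Poisson integral of its slice at
  \<open>\<eta>\<close>. If |k(x + iy)| > c, the Poisson average of the squared slice must exceed
  c^2, so around y some interval carries a large share of that square, and
  \<open>maximal_weak_type\<close> applies.\<close>

lemma radial_maximal_weak_type_shifted:
  assumes hol: "k holomorphic_on {w. Re w > 0}" and M: "\<And>w. Re w > 0 \<Longrightarrow> norm (k w) \<le> M"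
    and \<eta>: "\<eta> > 0" and c: "c > 0"
    and I: "integrable lborel (\<lambda>t. (norm (k (Complex \<eta> t)))\<^sup>2)" "(LINT t|lborel. (norm (k (Complex \<eta> t)))\<^sup>2) \<le> I"
  shows "emeasure lborel {y. \<exists>x>\<eta>. norm (k (Complex x y)) > c} \<le> ennreal (80 * I / (pi * c\<^sup>2))"
proof -
  define h where "h t = (norm (k (Complex \<eta> t)))\<^sup>2" for t
  \<comment> \<open>Chosen so that 8 m / pi = c^2 in the Poisson bound; then 10 I / m is the
    constant claimed.\<close>
  define m where "m = pi * c\<^sup>2 / 8"
  have m: "m > 0"
    using c by (simp add: m_def)
  have contk: "continuous_on {w. Re w > 0} k"
    using hol by (rule holomorphic_on_imp_continuous_on)
  have contk\<eta>: "continuous_on UNIV (\<lambda>t. k (Complex \<eta> t))"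
    by (rule continuous_on_vertical_line[OF contk]) (use \<eta> in auto)
  have [measurable]: "(\<lambda>t. k (Complex \<eta> t)) \<in> borel_measurable borel"
    using contk\<eta> by (rule borel_measurable_continuous_onI)
  have [measurable]: "h \<in> borel_measurable borel"
    unfolding h_def by measurable
  have h0: "h t \<ge> 0" for t
    by (simp add: h_def)
  have inth: "integrable lborel h"
    using I(1) unfolding h_def[abs_def] .
  have "emeasure lborel {y. \<exists>x>\<eta>. norm (k (Complex x y)) > c} \<le> ennreal (10 * I / m)"
  proof (rule maximal_weak_type[where h = h])
    show "{y. \<exists>x>\<eta>. norm (k (Complex x y)) > c} \<in> sets borel"
      using contk \<eta> by (intro borel_open open_vertical_translates_large) auto
    show "(\<integral>\<^sup>+t. ennreal (h t) \<partial>lborel) \<le> ennreal I"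
      using I h0 inth by (simp add: nn_integral_eq_integral ennreal_leI) (simp add: h_def ennreal_leI)
    fix y assume "y \<in> {y. \<exists>x>\<eta>. norm (k (Complex x y)) > c}"
    then obtain x where x: "x > \<eta>" "norm (k (Complex x y)) > c"
      by auto
    let ?p = "\<lambda>t. poisson_kernel (x - \<eta>) (y - t)"
    have p: "integrable lborel ?p" "integral\<^sup>L lborel ?p = 1"
      using poisson_kernel_has_integral[of "x - \<eta>" y] x by (auto simp: has_bochner_integral_iff)
    have p0: "?p t \<ge> 0" for t
      using x by (intro poisson_kernel_nonneg) auto
    show "\<exists>r>0. ennreal (m * r) < (\<integral>\<^sup>+t. ennreal (h t) * indicator (cball y r) t \<partial>lborel)"
    proof (rule ccontr)
      assume "\<not> ?thesis"
      then have "(\<integral>\<^sup>+t. ennreal (?p t * h t) \<partial>lborel) \<le> ennreal (8 * m / pi)"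
        using x m h0 by (intro poisson_integral_le_of_interval_bound) (auto simp: not_less not_le[symmetric])
      then have nn: "(\<integral>\<^sup>+t. ennreal (?p t * h t) \<partial>lborel) \<le> ennreal (c\<^sup>2)"
        by (simp add: m_def)
      have "integrable lborel (\<lambda>t. ?p t * h t)"
        using nn p0 h0 by (intro integrableI_nonneg) (auto simp: top_unique intro: le_less_trans)
      then have ph: "integrable lborel (\<lambda>t. ?p t * h t)" "(LINT t|lborel. ?p t * h t) \<le> c\<^sup>2"
        using nn p0 h0 by (auto simp: nn_integral_eq_integral)
      have "k (Complex x y) = (LINT t|lborel. ?p t *\<^sub>R k (Complex \<eta> t))"
      proof -
        have "(LINT t|lborel. poisson_kernel (Re (Complex (x - \<eta>) y)) (Im (Complex (x - \<eta>) y) - t) *\<^sub>R k (Complex 0 t + of_real \<eta>))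
            = k (Complex (x - \<eta>) y + of_real \<eta>)"
        proof (rule poisson_formula[where d = \<eta> and M = M])
          have "(k \<circ> (\<lambda>w. w + of_real \<eta>)) holomorphic_on {w. Re w > - \<eta>}"
            by (intro holomorphic_on_compose_gen[OF _ hol] holomorphic_intros) auto
          then show "(\<lambda>w. k (w + of_real \<eta>)) holomorphic_on {w. Re w > - \<eta>}"
            by (simp add: o_def)
        qed (use \<eta> M x in auto)
        moreover have "Complex 0 t + of_real \<eta> = Complex \<eta> t" "Complex (x - \<eta>) y + of_real \<eta> = Complex x y" for t
          by (simp_all add: complex_eq_iff)
        ultimately show ?thesis
          by simp
      qed
      then have "norm (k (Complex x y)) \<le> (LINT t|lborel. norm (?p t *\<^sub>R k (Complex \<eta> t)))"
        by (simp only: integral_norm_bound)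
      \<comment> \<open>Cauchy-Schwarz replaced by |k| <= |k|^2 / (2 c) + c / 2, which is sharp at
        |k| = c; the Poisson average of the right side is then at most c.\<close>
      also have "\<dots> \<le> (LINT t|lborel. 1 / (2 * c) * (?p t * h t) + c / 2 * ?p t)"
      proof (rule integral_mono_AE')
        show "integrable lborel (\<lambda>t. 1 / (2 * c) * (?p t * h t) + c / 2 * ?p t)"
          using ph p by (intro Bochner_Integration.integrable_add integrable_mult_right)
        show "AE t in lborel. norm (?p t *\<^sub>R k (Complex \<eta> t)) \<le> 1 / (2 * c) * (?p t * h t) + c / 2 * ?p t"
        proof (intro AE_I2)
          fix t
          have "2 * c * norm (k (Complex \<eta> t)) \<le> h t + c\<^sup>2"
            using zero_le_power2[of "norm (k (Complex \<eta> t)) - c"] by (simp add: h_def power2_diff algebra_simps)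
          then have "norm (k (Complex \<eta> t)) \<le> 1 / (2 * c) * h t + c / 2"
            using c by (simp add: field_simps power2_eq_square)
          from mult_left_mono[OF this p0[of t]] p0[of t]
          show "norm (?p t *\<^sub>R k (Complex \<eta> t)) \<le> 1 / (2 * c) * (?p t * h t) + c / 2 * ?p t"
            by (simp add: algebra_simps)
        qed
      qed (use p0 h0 c in auto)
      also have "\<dots> = 1 / (2 * c) * (LINT t|lborel. ?p t * h t) + c / 2"
        using ph(1) p by simp
      also have "\<dots> \<le> 1 / (2 * c) * c\<^sup>2 + c / 2"
        using ph(2) c by (intro add_right_mono mult_left_mono) auto
      also have "\<dots> = c"
        using c by (simp add: power2_eq_square)
      finally show False
        using x by simp
    qed
  qed (use m in auto)
  then show ?thesis
    by (simp add: m_def)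
qed

text \<open>The shifted estimate has a constant independent of \<open>\<eta>\<close>, and its sets
  increase to the full one as \<open>\<eta>\<close> decreases to 0, so continuity from below of the
  measure carries it over.\<close>

lemma radial_maximal_weak_type:
  assumes hol: "k holomorphic_on {w. Re w > 0}" and M: "\<And>w. Re w > 0 \<Longrightarrow> norm (k w) \<le> M"
    and c: "c > 0" and \<eta>: "\<eta>\<^sub>0 > 0"
    and I: "\<And>\<eta>. 0 < \<eta> \<Longrightarrow> \<eta> < \<eta>\<^sub>0 \<Longrightarrow> integrable lborel (\<lambda>t. (norm (k (Complex \<eta> t)))\<^sup>2)"
      "\<And>\<eta>. 0 < \<eta> \<Longrightarrow> \<eta> < \<eta>\<^sub>0 \<Longrightarrow> (LINT t|lborel. (norm (k (Complex \<eta> t)))\<^sup>2) \<le> I"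
  shows "emeasure lborel {y. \<exists>x>0. norm (k (Complex x y)) > c} \<le> ennreal (80 * I / (pi * c\<^sup>2))"
proof -
  \<comment> \<open>The offset 2 keeps \<open>e 0\<close> strictly below
    \<open>\<eta>\<^sub>0\<close>.\<close>
  define e where "e n = \<eta>\<^sub>0 / real (n + 2)" for n
  have e: "0 < e n" "e n < \<eta>\<^sub>0" for n
    using \<eta> by (auto simp: e_def field_simps add_pos_nonneg)
  have e_lim: "e \<longlonglongrightarrow> 0"
    unfolding e_def by real_asymp
  let ?E = "\<lambda>a. {y. \<exists>x>a. norm (k (Complex x y)) > c}"
  have "?E 0 = (\<Union>n. ?E (e n))"
  proof
    show "?E 0 \<subseteq> (\<Union>n. ?E (e n))"
    proof clarsimp
      fix y x assume "x > 0" "c < norm (k (Complex x y))"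
      moreover obtain n where "e n < x"
        using order_tendstoD(2)[OF e_lim \<open>x > 0\<close>] by (auto simp: eventually_sequentially)
      ultimately show "\<exists>n. \<exists>x>e n. c < norm (k (Complex x y))"
        by blast
    qed
    show "(\<Union>n. ?E (e n)) \<subseteq> ?E 0"
      using e(1) by (auto intro: less_trans)
  qed
  also have "emeasure lborel \<dots> = (SUP n. emeasure lborel (?E (e n)))"
  proof (rule SUP_emeasure_incseq[symmetric])
    show "range (\<lambda>n. ?E (e n)) \<subseteq> sets lborel"
      using e(1) open_vertical_translates_large[OF holomorphic_on_imp_continuous_on[OF hol]]
      by (auto simp: less_imp_le)
    show "incseq (\<lambda>n. ?E (e n))"
    proof (rule incseq_SucI)
      fix n
      have "e (Suc n) \<le> e n"
        using \<eta> by (simp add: e_def frac_le)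
      then show "?E (e n) \<subseteq> ?E (e (Suc n))"
        by (auto intro: le_less_trans)
    qed
  qed
  also have "\<dots> \<le> ennreal (80 * I / (pi * c\<^sup>2))"
    using e by (intro SUP_least radial_maximal_weak_type_shifted[OF hol M _ c I]) auto
  finally show ?thesis .
qed

section \<open>Fatou's theorem\<close>

lemma vertical_line_integrable:
  fixes q :: "complex \<Rightarrow> 'a :: {banach, second_countable_topology}"
  assumes "continuous_on {w. Re w > 0} q" "x > 0" "\<And>t. norm (q (Complex x t)) \<le> C / (1 + t\<^sup>2)"
  shows "integrable lborel (\<lambda>t. q (Complex x t))"
proof (rule Bochner_Integration.integrable_bound)
  show "integrable lborel (\<lambda>t::real. C * (1 / (1 + t\<^sup>2)))"
    by (intro integrable_mult_right integrable_inverse_1_plus_square_UNIV)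
  have "continuous_on UNIV (Complex x)"
    unfolding Complex_Re_Im_eq by (intro continuous_intros)
  then have "continuous_on UNIV (\<lambda>t. q (Complex x t))"
    using assms(2) by (intro continuous_on_compose2[OF assms(1)]) auto
  then show "(\<lambda>t. q (Complex x t)) \<in> borel_measurable lborel"
    by (simp add: borel_measurable_continuous_onI)
  show "AE t in lborel. norm (q (Complex x t)) \<le> norm (C * (1 / (1 + t\<^sup>2)))"
  proof (intro AE_I2 order_trans[OF assms(3)])
    show "C / (1 + t\<^sup>2) \<le> norm (C * (1 / (1 + t\<^sup>2)))" for t
      using abs_ge_self[of "C * (1 / (1 + t\<^sup>2))"] by simp
  qed
qed

text \<open>If N b > N a, the increments of N along the progression a, b, 2b - a, ... are
  nondecreasing by midpoint convexity, so N grows at least linearly there and exceeds every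
  bound.\<close>

lemma midpoint_convex_bounded_decreasing:
  fixes N :: "real \<Rightarrow> real"
  assumes mid: "\<And>a b. a > 0 \<Longrightarrow> b > 0 \<Longrightarrow> 2 * N ((a + b) / 2) \<le> N a + N b"
    and bdd: "\<And>a. a > 0 \<Longrightarrow> N a \<le> B" and ab: "0 < a" "a < b"
  shows "N b \<le> N a"
proof (rule ccontr)
  assume "\<not> N b \<le> N a"
  define D where "D = N b - N a"
  define d where "d = b - a"
  define s where "s n = a + real n * d" for n
  have "D > 0" "d > 0"
    using \<open>\<not> N b \<le> N a\<close> ab by (auto simp: D_def d_def)
  have s: "s n > 0" for n
    using ab \<open>d > 0\<close> by (simp add: s_def add_pos_nonneg)
  have step: "N (s (Suc n)) - N (s n) \<ge> D" for n
  proof (induction n)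
    case 0
    show ?case
      by (simp add: s_def d_def D_def)
  next
    case (Suc n)
    have "(s (Suc (Suc n)) + s n) / 2 = s (Suc n)"
      by (simp add: s_def field_simps)
    then have "2 * N (s (Suc n)) \<le> N (s (Suc (Suc n))) + N (s n)"
      using mid[OF s s, of "Suc (Suc n)" n] by simp
    then show ?case
      using Suc by linarith
  qed
  have lower: "N a + real n * D \<le> N (s n)" for n
  proof (induction n)
    case 0
    show ?case
      by (simp add: s_def)
  next
    case (Suc n)
    then show ?case
      using step[of n] by (simp add: algebra_simps)
  qed
  obtain n where "B - N a < real n * D"
    using reals_Archimedean3[OF \<open>D > 0\<close>] by blast
  then show False
    using lower[of n] bdd[OF s, of n] by linarith
qed

text \<open>With s = a + b, the reflection w |-> s - cnj w exchanges the lines of abscissa u and s -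
  u and keeps the imaginary part. Hence \<open>k\<close> restricts to the integrand of the pairing
  at abscissa a and to |g|^2 at s / 2, and it is analytic in the strip between 0 and s.\<close>

lemma vertical_slices_pairing:
  assumes hol: "g holomorphic_on {w. Re w > 0}"
    and decay: "\<And>w. Re w > 0 \<Longrightarrow> (norm (g w))\<^sup>2 \<le> C / (1 + (Im w)\<^sup>2)"
    and a: "0 < a" and b: "0 < b"
  shows "(LINT t|lborel. g (Complex a t) * cnj (g (Complex b t)))
    = of_real (LINT t|lborel. (norm (g (Complex ((a + b) / 2) t)))\<^sup>2)"
proof -
  define s where "s = a + b"
  define S where "S = {w. Re w > 0} \<inter> {w. Re w < s}"
  define k where "k w = g w * cnj (g (of_real s - cnj w))" for w
  have S: "convex S" "open S"
    unfolding S_def by (auto intro!: convex_Int open_Int convex_halfspace_Re_gt convex_halfspace_Re_lt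
        open_halfspace_Re_gt open_halfspace_Re_lt)
  \<comment> \<open>Composing this analytic function with w |-> s - w gives the second factor of
    \<open>k\<close>.\<close>
  have "cnj \<circ> g \<circ> cnj holomorphic_on {w. Re w > 0}"
  proof (rule holomorphic_on_compose_cnj_cnj)
    show "g holomorphic_on cnj ` {w. 0 < Re w}"
      by (rule holomorphic_on_subset[OF hol]) auto
  qed (rule open_halfspace_Re_gt)
  then have "(cnj \<circ> g \<circ> cnj) \<circ> (\<lambda>w. of_real s - w) holomorphic_on S"
    by (intro holomorphic_on_compose_gen[of "\<lambda>w. of_real s - w" S "cnj \<circ> g \<circ> cnj" "{w. Re w > 0}"])
      (auto simp: S_def intro!: holomorphic_intros)
  moreover have "(cnj \<circ> g \<circ> cnj) \<circ> (\<lambda>w. of_real s - w) = (\<lambda>w. cnj (g (of_real s - cnj w)))"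
    by (simp add: fun_eq_iff)
  ultimately have k: "k holomorphic_on S"
    unfolding k_def[abs_def]
    by (intro holomorphic_on_mult holomorphic_on_subset[OF hol]) (auto simp: S_def)
  have kbound: "norm (k w) \<le> C / (1 + (Im w)\<^sup>2)" if "0 < Re w" "Re w < s" for w
  proof -
    let ?A = "norm (g w)" and ?B = "norm (g (of_real s - cnj w))"
    have "?A\<^sup>2 \<le> C / (1 + (Im w)\<^sup>2)" "?B\<^sup>2 \<le> C / (1 + (Im w)\<^sup>2)"
      using decay[of w] decay[of "of_real s - cnj w"] that by auto
    moreover have "2 * (?A * ?B) \<le> ?A\<^sup>2 + ?B\<^sup>2"
      using zero_le_power2[of "?A - ?B"] by (simp add: power2_diff algebra_simps)
    ultimately show ?thesis
      by (simp add: k_def norm_mult)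
  qed
  have C: "C \<ge> 0"
    using decay[of 1] order_trans[OF zero_le_power2] by fastforce
  have shift: "(LINT t|lborel. k (Complex u1 t)) = (LINT t|lborel. k (Complex u2 t))"
    if u: "0 < u1" "u1 \<le> u2" "u2 < s" for u1 u2
  proof (rule vertical_integral_shift[OF S k u(2), where R = 1 and C = C])
    fix w assume w: "u1 \<le> Re w" "Re w \<le> u2"
    then show "w \<in> S"
      using u by (auto simp: S_def)
    assume "1 \<le> \<bar>Im w\<bar>"
    then have im: "Im w \<noteq> 0"
      by auto
    have "norm (k w) \<le> C / (1 + (Im w)\<^sup>2)"
      using w u by (intro kbound) auto
    also have "\<dots> \<le> C / (Im w)\<^sup>2"
      using C im by (intro divide_left_mono mult_pos_pos) (auto simp: add_pos_nonneg)
    finally show "norm (k w) \<le> C / (Im w)\<^sup>2" .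
  qed
  \<comment> \<open>The shift is oriented from left to right, so the side of s / 2 on which a lies
    decides its direction.\<close>
  have "(LINT t|lborel. k (Complex a t)) = (LINT t|lborel. k (Complex (s / 2) t))"
  proof (cases "a \<le> s / 2")
    case True
    then show ?thesis
      using a b by (intro shift) (auto simp: s_def)
  next
    case False
    then show ?thesis
      using a b by (intro shift[symmetric]) (auto simp: s_def)
  qed
  moreover have "k (Complex a t) = g (Complex a t) * cnj (g (Complex b t))" for t
  proof -
    have "of_real s - cnj (Complex a t) = Complex b t"
      by (simp add: s_def complex_eq_iff)
    then show ?thesis
      by (simp add: k_def)
  qed
  moreover have "k (Complex (s / 2) t) = of_real ((norm (g (Complex (s / 2) t)))\<^sup>2)" for t
  proof -
    have "of_real s - cnj (Complex (s / 2) t) = Complex (s / 2) t"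
      by (simp add: complex_eq_iff)
    then show ?thesis
      unfolding k_def complex_norm_square by (rule arg_cong)
  qed
  ultimately show ?thesis
    by (simp only: integral_complex_of_real s_def)
qed

text \<open>Expanding the square and using the pairing, the squared distance of two slices is N a +
  N b - 2 N((a + b) / 2). Nonnegativity makes N midpoint convex, hence decreasing. Once N is within
  \<open>\<epsilon>\<close> / 2 of its supremum L on (0, \<open>\<delta>\<close>], the expression is
  at most 2 L - 2 (L - \<open>\<epsilon>\<close> / 2).\<close>

lemma vertical_slices_L2_Cauchy:
  assumes hol: "g holomorphic_on {w. Re w > 0}"
    and decay: "\<And>w. Re w > 0 \<Longrightarrow> (norm (g w))\<^sup>2 \<le> C / (1 + (Im w)\<^sup>2)" and \<epsilon>: "\<epsilon> > 0"
  shows "\<exists>\<delta>>0. \<forall>a\<in>{0<..\<delta>}. \<forall>b\<in>{0<..\<delta>}.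
      integrable lborel (\<lambda>t. (norm (g (Complex a t) - g (Complex b t)))\<^sup>2) \<and>
      (LINT t|lborel. (norm (g (Complex a t) - g (Complex b t)))\<^sup>2) \<le> \<epsilon>"
proof -
  have cont: "continuous_on {w. Re w > 0} g"
    using hol by (rule holomorphic_on_imp_continuous_on)
  define N where "N a = (LINT t|lborel. (norm (g (Complex a t)))\<^sup>2)" for a
  have C: "C \<ge> 0"
    using decay[of 1] order_trans[OF zero_le_power2] by fastforce
  have int: "integrable lborel (\<lambda>t. (norm (g (Complex a t)))\<^sup>2)" if "a > 0" for a
  proof (rule vertical_line_integrable[where q = "\<lambda>w. (norm (g w))\<^sup>2" and C = C])
    show "continuous_on {w. Re w > 0} (\<lambda>w. (norm (g w))\<^sup>2)"
      by (intro continuous_intros cont)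
    show "norm ((norm (g (Complex a t)))\<^sup>2) \<le> C / (1 + t\<^sup>2)" for t
      using decay[of "Complex a t"] that by simp
  qed (rule that)
  have NB: "N a \<le> C * (LINT t|lborel. 1 / (1 + t\<^sup>2))" if "a > 0" for a
  proof -
    have "N a \<le> (LINT t|lborel. C * (1 / (1 + t\<^sup>2)))"
      unfolding N_def
    proof (intro integral_mono int that integrable_mult_right integrable_inverse_1_plus_square_UNIV)
      show "(norm (g (Complex a t)))\<^sup>2 \<le> C * (1 / (1 + t\<^sup>2))" for t
        using decay[of "Complex a t"] that by simp
    qed
    then show ?thesis
      by (simp only: integral_mult_right_zero)
  qed
  have diff: "integrable lborel (\<lambda>t. (norm (g (Complex a t) - g (Complex b t)))\<^sup>2)"
    "(LINT t|lborel. (norm (g (Complex a t) - g (Complex b t)))\<^sup>2) = N a + N b - 2 * N ((a + b) / 2)"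
    if ab: "a > 0" "b > 0" for a b
  proof -
    let ?k = "\<lambda>t. g (Complex a t) * cnj (g (Complex b t))"
    have intk: "integrable lborel ?k"
    proof (rule Bochner_Integration.integrable_bound[OF Bochner_Integration.integrable_add[OF int[OF ab(1)] int[OF ab(2)]]])
      have "continuous_on UNIV ?k"
        using ab by (intro continuous_intros continuous_on_vertical_line[OF cont]) auto
      then show "?k \<in> borel_measurable lborel"
        by (simp add: borel_measurable_continuous_onI)
      show "AE t in lborel. norm (?k t) \<le> norm ((norm (g (Complex a t)))\<^sup>2 + (norm (g (Complex b t)))\<^sup>2)"
      proof (intro AE_I2)
        fix t
        let ?A = "norm (g (Complex a t))" and ?B = "norm (g (Complex b t))"
        have "2 * (?A * ?B) \<le> ?A\<^sup>2 + ?B\<^sup>2"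
          using zero_le_power2[of "?A - ?B"] by (simp add: power2_diff algebra_simps)
        moreover have "0 \<le> ?A * ?B"
          by simp
        ultimately show "norm (?k t) \<le> norm (?A\<^sup>2 + ?B\<^sup>2)"
          unfolding norm_mult complex_mod_cnj real_norm_def by linarith
      qed
    qed
    have eq: "(norm (g (Complex a t) - g (Complex b t)))\<^sup>2
        = (norm (g (Complex a t)))\<^sup>2 + (norm (g (Complex b t)))\<^sup>2 - 2 * Re (?k t)" for t
      by (simp add: cmod_power2 power2_diff algebra_simps)
    have intr: "integrable lborel (\<lambda>t. 2 * Re (?k t))"
      by (intro integrable_mult_right integrable_Re intk)
    show "integrable lborel (\<lambda>t. (norm (g (Complex a t) - g (Complex b t)))\<^sup>2)"
      unfolding eq
      by (intro Bochner_Integration.integrable_diff Bochner_Integration.integrable_add int ab intr)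
    have "integral\<^sup>L lborel ?k = of_real (N ((a + b) / 2))"
      unfolding N_def by (rule vertical_slices_pairing[OF hol decay ab])
    then have "(LINT t|lborel. Re (?k t)) = N ((a + b) / 2)"
      using intk by (simp only: integral_Re Re_complex_of_real)
    then show "(LINT t|lborel. (norm (g (Complex a t) - g (Complex b t)))\<^sup>2) = N a + N b - 2 * N ((a + b) / 2)"
      unfolding eq
      by (simp only: Bochner_Integration.integral_diff[OF Bochner_Integration.integrable_add[OF int[OF ab(1)] int[OF ab(2)]] intr]
          Bochner_Integration.integral_add[OF int[OF ab(1)] int[OF ab(2)]] integral_mult_right_zero N_def)
  qed
  have mid: "2 * N ((a + b) / 2) \<le> N a + N b" if "a > 0" "b > 0" for a b
  proof -
    have "0 \<le> (LINT t|lborel. (norm (g (Complex a t) - g (Complex b t)))\<^sup>2)"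
      by simp
    then show ?thesis
      unfolding diff(2)[OF that] by simp
  qed
  have decreasing: "N b \<le> N a" if "0 < a" "a \<le> b" for a b
    using midpoint_convex_bounded_decreasing[of N, OF mid NB] that by (cases "a = b") auto
  \<comment> \<open>As N is decreasing, this supremum is its limit at 0.\<close>
  define L where "L = (SUP a\<in>{0<..}. N a)"
  have bdd: "bdd_above (N ` {0<..})"
    using NB by (auto simp: bdd_above_def)
  have NL: "N a \<le> L" if "a > 0" for a
    unfolding L_def using that by (intro cSUP_upper bdd) auto
  have "L - \<epsilon> / 2 < L"
    using \<epsilon> by simp
  then obtain \<delta> where \<delta>: "\<delta> > 0" "L - \<epsilon> / 2 < N \<delta>"
    unfolding L_def by (subst (asm) less_cSUP_iff[OF _ bdd]) auto
  show ?thesis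
  proof (intro exI[of _ \<delta>] conjI ballI \<delta>(1))
    fix a b assume "a \<in> {0<..\<delta>}" "b \<in> {0<..\<delta>}"
    then have ab: "0 < a" "a \<le> \<delta>" "0 < b" "b \<le> \<delta>"
      by auto
    show "integrable lborel (\<lambda>t. (norm (g (Complex a t) - g (Complex b t)))\<^sup>2)"
      using ab by (intro diff)
    have "N \<delta> \<le> N ((a + b) / 2)"
      by (rule decreasing) (use ab in auto)
    then show "(LINT t|lborel. (norm (g (Complex a t) - g (Complex b t)))\<^sup>2) \<le> \<epsilon>"
      unfolding diff(2)[OF ab(1,3)] using \<delta>(2) NL[OF ab(1)] NL[OF ab(3)] by linarith
  qed
qed

text \<open>\<open>E d c\<close> collects the y for which g(x + iy) and g(x + d + iy) differ by more
  than c at some x > 0; its measure tends to 0 with d. For almost every y and every c, some d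
  therefore keeps the two within c for all x > 0. The shifted function converges as x tends to 0
  because g is continuous inside the half plane, so the unshifted one is Cauchy.\<close>

lemma AE_radial_limit_of_decay:
  assumes hol: "g holomorphic_on {w. Re w > 0}" and M: "\<And>w. Re w > 0 \<Longrightarrow> norm (g w) \<le> M"
    and decay: "\<And>w. Re w > 0 \<Longrightarrow> (norm (g w))\<^sup>2 \<le> C / (1 + (Im w)\<^sup>2)"
  shows "AE y in lborel. \<exists>l. ((\<lambda>x. g (Complex x y)) \<longlongrightarrow> l) (at_right 0)"
proof -
  have cont: "continuous_on {w. Re w > 0} g"
    using hol by (rule holomorphic_on_imp_continuous_on)
  define k where "k d w = g w - g (w + of_real d)" for d w
  define E where "E d c = {y. \<exists>x>0. norm (k d (Complex x y)) > c}" for d c :: real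
  have k_Complex: "k d (Complex x y) = g (Complex x y) - g (Complex (x + d) y)" for d x y
  proof -
    have "Complex x y + of_real d = Complex (x + d) y"
      by (simp add: complex_eq_iff)
    then show ?thesis
      by (simp add: k_def)
  qed
  have holk: "k d holomorphic_on {w. Re w > 0}" if "d > 0" for d
  proof -
    have "(g \<circ> (\<lambda>w. w + of_real d)) holomorphic_on {w. Re w > 0}"
      using that by (intro holomorphic_on_compose_gen[OF _ hol] holomorphic_intros) auto
    then show ?thesis
      unfolding k_def[abs_def] by (intro holomorphic_on_diff hol) (simp add: o_def)
  qed
  have Mk: "norm (k d w) \<le> 2 * M" if "d > 0" "Re w > 0" for d w
    unfolding k_def using norm_triangle_ineq4[of "g w" "g (w + of_real d)"] M[of w] M[of "w + of_real d"] that
    by auto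
  have E_sets: "E d c \<in> sets borel" if "d > 0" for d c
    unfolding E_def
    by (intro borel_open open_vertical_translates_large holomorphic_on_imp_continuous_on holk that order_refl)
  have small: "\<exists>\<delta>>0. \<forall>d. 0 < d \<longrightarrow> d < \<delta> \<longrightarrow> emeasure lborel (E d c) \<le> ennreal e" if c: "c > 0" and e: "e > 0" for c e :: real
  proof -
    \<comment> \<open>Solves 80 \<open>\<epsilon>\<close> / (pi c^2) = e, the constant of the
      maximal estimate.\<close>
    define \<epsilon> where "\<epsilon> = e * (pi * c\<^sup>2) / 80"
    have "\<epsilon> > 0"
      using c e by (simp add: \<epsilon>_def)
    from vertical_slices_L2_Cauchy[OF hol decay this]
    obtain \<delta> where \<delta>: "\<delta> > 0" and cauchy: "\<forall>a\<in>{0<..\<delta>}. \<forall>b\<in>{0<..\<delta>}.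
        integrable lborel (\<lambda>t. (norm (g (Complex a t) - g (Complex b t)))\<^sup>2) \<and>
        (LINT t|lborel. (norm (g (Complex a t) - g (Complex b t)))\<^sup>2) \<le> \<epsilon>"
      by blast
    have "emeasure lborel (E d c) \<le> ennreal (80 * \<epsilon> / (pi * c\<^sup>2))" if d: "0 < d" "d < \<delta>" for d
      unfolding E_def
    proof (rule radial_maximal_weak_type[OF holk[OF d(1)] Mk[OF d(1)] c])
      \<comment> \<open>Below this abscissa both \<open>\<eta>\<close> and \<open>\<eta> + d\<close>
        lie in the range of the Cauchy estimate.\<close>
      show "\<delta> - d > 0"
        using d by simp
      fix \<eta> assume "0 < \<eta>" "\<eta> < \<delta> - d"
      then show "integrable lborel (\<lambda>t. (norm (k d (Complex \<eta> t)))\<^sup>2)"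
        "(LINT t|lborel. (norm (k d (Complex \<eta> t)))\<^sup>2) \<le> \<epsilon>"
        using cauchy[rule_format, of \<eta> "\<eta> + d"] d by (auto simp: k_Complex)
    qed
    then have "\<forall>d. 0 < d \<longrightarrow> d < \<delta> \<longrightarrow> emeasure lborel (E d c) \<le> ennreal e"
      using c by (simp add: \<epsilon>_def)
    with \<delta> show ?thesis
      by blast
  qed
  define d where "d n = 1 / real (Suc n)" for n
  have d: "d n > 0" for n
    by (simp add: d_def)
  have d_lim: "d \<longlonglongrightarrow> 0"
    unfolding d_def by real_asymp
  have null: "(\<Inter>n. E (d n) c) \<in> null_sets lborel" if c: "c > 0" for c
  proof (rule null_setsI[rotated])
    show "(\<Inter>n. E (d n) c) \<in> sets lborel"
      using E_sets d by auto
    have "emeasure lborel (\<Inter>n. E (d n) c) \<le> ennreal e" if e: "e > 0" for e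
    proof -
      obtain \<delta> where "\<delta> > 0" "\<forall>d. 0 < d \<longrightarrow> d < \<delta> \<longrightarrow> emeasure lborel (E d c) \<le> ennreal e"
        using small[OF c e] by blast
      moreover obtain n where "d n < \<delta>"
        using order_tendstoD(2)[OF d_lim \<open>\<delta> > 0\<close>] by (auto simp: eventually_sequentially)
      ultimately have "emeasure lborel (E (d n) c) \<le> ennreal e"
        using d by blast
      moreover have "emeasure lborel (\<Inter>n. E (d n) c) \<le> emeasure lborel (E (d n) c)"
        using E_sets d by (intro emeasure_mono) auto
      ultimately show ?thesis
        by (rule order_trans[rotated])
    qed
    then show "emeasure lborel (\<Inter>n. E (d n) c) = 0"
      using ennreal_le_epsilon[of 0] by fastforce
  qed
  \<comment> \<open>The thresholds run through the same null sequence as the shifts, so only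
    countably many null sets are discarded.\<close>
  have "AE y in lborel. \<forall>j. y \<notin> (\<Inter>n. E (d n) (d j))"
    unfolding AE_all_countable using null d by (intro allI AE_not_in) auto
  then show ?thesis
  proof (eventually_elim)
    fix y assume y: "\<forall>j. y \<notin> (\<Inter>n. E (d n) (d j))"
    let ?f = "\<lambda>x. g (Complex x y)"
    have "cauchy_filter (filtermap ?f (at_right 0))"
      unfolding cauchy_filter_metric_filtermap
    proof (intro allI impI)
      fix e :: real assume "e > 0"
      \<comment> \<open>Four quarters of e: each of the two points is within e / 4 of its translate,
        and each translate within e / 4 of the anchor at abscissa \<open>d n\<close>.\<close>
      then obtain j where j: "d j < e / 4"
        using order_tendstoD(2)[OF d_lim, of "e / 4"] by (auto simp: eventually_sequentially)
      obtain n where n: "y \<notin> E (d n) (d j)"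
        using y by blast
      have osc: "dist (?f x) (?f (x + d n)) \<le> d j" if "x > 0" for x
        using n that unfolding E_def k_Complex mem_Collect_eq dist_norm by (meson not_less)
      have "((\<lambda>x. Complex (x + d n) y) \<longlongrightarrow> Complex (0 + d n) y) (at_right 0)"
        by (intro tendsto_intros)
      then have "((\<lambda>x. ?f (x + d n)) \<longlongrightarrow> g (Complex (0 + d n) y)) (at_right 0)"
        by (rule continuous_on_tendsto_compose[OF cont])
          (use d[of n] in \<open>auto simp: eventually_at_right_field intro!: exI[of _ 1]\<close>)
      then have lim: "\<forall>\<^sub>F x in at_right 0. dist (?f (x + d n)) (?f (d n)) < e / 4"
        using \<open>e > 0\<close> by (intro tendstoD) auto
      show "\<exists>P. eventually P (at_right 0) \<and> (\<forall>x x'. P x \<and> P x' \<longrightarrow> dist (?f x) (?f x') < e)"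
      proof (intro exI conjI allI impI)
        show "\<forall>\<^sub>F x in at_right 0. x > 0 \<and> dist (?f (x + d n)) (?f (d n)) < e / 4"
          using lim eventually_at_right_less by eventually_elim auto
        fix x x' :: real
        assume *: "(x > 0 \<and> dist (?f (x + d n)) (?f (d n)) < e / 4) \<and> (x' > 0 \<and> dist (?f (x' + d n)) (?f (d n)) < e / 4)"
        have "dist (?f x) (?f (d n)) < e / 2" "dist (?f x') (?f (d n)) < e / 2"
          using * j osc[of x] osc[of x'] dist_triangle[of "?f x" "?f (d n)" "?f (x + d n)"]
            dist_triangle[of "?f x'" "?f (d n)" "?f (x' + d n)"] by linarith+
        then show "dist (?f x) (?f x') < e"
          using dist_triangle2[of "?f x" "?f x'" "?f (d n)"] by linarith
      qed
    qed
    then show "\<exists>l. (?f \<longlongrightarrow> l) (at_right 0)"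
      using cauchy_filter_complete_converges[of "filtermap ?f (at_right 0)" UNIV] complete_UNIV
      by (auto simp: filterlim_def filtermap_bot_iff)
  qed
qed

text \<open>Slices of a bounded function need not lie in L^2. Since |1 + w|^2 >= 1 + (Im w)^2,
  division by 1 + w makes them square integrable uniformly in the abscissa; multiplying back by a
  factor with a finite boundary limit preserves convergence.\<close>

theorem Fatou_AE_radial_limit:
  assumes hol: "f holomorphic_on {w. Re w > 0}" and M: "\<And>w. Re w > 0 \<Longrightarrow> norm (f w) \<le> M"
  shows "AE y in lborel. \<exists>l. ((\<lambda>x. f (Complex x y)) \<longlongrightarrow> l) (at_right 0)"
proof -
  define g where "g w = f w / (1 + w)" for w
  have nz: "1 + w \<noteq> 0" if "Re w > 0" for w
    using that by (auto simp: complex_eq_iff)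
  have M0: "M \<ge> 0"
    using order_trans[OF norm_ge_zero M[of 1]] by simp
  have ge: "1 + (Im w)\<^sup>2 \<le> (norm (1 + w))\<^sup>2" if "Re w > 0" for w
    using that unfolding cmod_power2 by (simp add: power2_eq_square algebra_simps)
  have decay: "(norm (g w))\<^sup>2 \<le> M\<^sup>2 / (1 + (Im w)\<^sup>2)" if "Re w > 0" for w
  proof -
    have "(norm (g w))\<^sup>2 = (norm (f w))\<^sup>2 / (norm (1 + w))\<^sup>2"
      by (simp add: g_def norm_divide power_divide)
    also have "\<dots> \<le> M\<^sup>2 / (1 + (Im w)\<^sup>2)"
      using M[OF that] ge[OF that] by (intro frac_le power_mono) (auto simp: add_pos_nonneg)
    finally show ?thesis .
  qed
  have "AE y in lborel. \<exists>l. ((\<lambda>x. g (Complex x y)) \<longlongrightarrow> l) (at_right 0)"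
  proof (rule AE_radial_limit_of_decay)
    show "g holomorphic_on {w. Re w > 0}"
      unfolding g_def[abs_def] using nz by (intro holomorphic_intros hol) auto
    show "norm (g w) \<le> M" if "Re w > 0" for w
    proof -
      have "(norm (g w))\<^sup>2 \<le> M\<^sup>2 / (1 + (Im w)\<^sup>2)"
        by (rule decay[OF that])
      also have "\<dots> \<le> M\<^sup>2 / 1"
        by (intro divide_left_mono) (auto simp: add_pos_nonneg)
      finally show ?thesis
        using M0 by (simp add: power2_le_iff_abs_le)
    qed
  qed (rule decay)
  then show ?thesis
  proof eventually_elim
    fix y assume "\<exists>l. ((\<lambda>x. g (Complex x y)) \<longlongrightarrow> l) (at_right 0)"
    then obtain l where "((\<lambda>x. g (Complex x y)) \<longlongrightarrow> l) (at_right 0)"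
      by blast
    moreover have "((\<lambda>x. 1 + Complex x y) \<longlongrightarrow> 1 + Complex 0 y) (at_right 0)"
      by (intro tendsto_intros)
    ultimately have "((\<lambda>x. g (Complex x y) * (1 + Complex x y)) \<longlongrightarrow> l * (1 + Complex 0 y)) (at_right 0)"
      by (rule tendsto_mult)
    moreover have "\<forall>\<^sub>F x in at_right 0. g (Complex x y) * (1 + Complex x y) = f (Complex x y)"
      using eventually_at_right_less[of 0] by eventually_elim (use nz in \<open>simp add: g_def\<close>)
    ultimately have "((\<lambda>x. f (Complex x y)) \<longlongrightarrow> l * (1 + Complex 0 y)) (at_right 0)"
      by (rule Lim_transform_eventually)
    then show "\<exists>l. ((\<lambda>x. f (Complex x y)) \<longlongrightarrow> l) (at_right 0)"
      by blast
  qed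
qed

section \<open>Poisson averages of bounded functions\<close>

lemma measurable_poisson_kernel_lebesgue [measurable]:
  "(\<lambda>t. poisson_kernel x (y - t)) \<in> borel_measurable lebesgue"
  by (intro measurable_completion) simp

lemma poisson_kernel_lebesgue:
  assumes "x > 0"
  shows "integrable lebesgue (\<lambda>t. poisson_kernel x (y - t))" "(LINT t|lebesgue. poisson_kernel x (y - t)) = 1"
  using poisson_kernel_has_integral[OF assms, of y]
  by (simp_all add: has_bochner_integral_iff integrable_completion integral_completion)

text \<open>The Poisson extension of \<open>\<psi>\<close>, evaluated at z. The integral is over
  \<open>lebesgue\<close> because members of \<open>Linf\<close> are only Lebesgue
  measurable.\<close>

definition poisson_average :: "complex \<Rightarrow> (real \<Rightarrow> complex) \<Rightarrow> complex" where
  "poisson_average z \<psi> = (LINT t|lebesgue. poisson_kernel (Re z) (Im z - t) *\<^sub>R \<psi> t)"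

section \<open>Essentially bounded functions and positivity of their Poisson averages\<close>

lemma Linf_normE:
  assumes "\<psi> \<in> Linf"
  obtains K where "K \<ge> 0" "Linf_norm \<psi> = ereal K" "AE t in lebesgue. norm (\<psi> t) \<le> K"
proof -
  have [measurable]: "\<psi> \<in> borel_measurable lebesgue"
    using assms by (simp add: Linf_def)
  \<comment> \<open>An \<open>ereal\<close> supremum could be minus infinity; comparison with the
    zero function, on a space of nonzero measure, rules this out.\<close>
  have "esssup lebesgue (\<lambda>y::real. 0 :: ereal) \<le> Linf_norm \<psi>"
    unfolding Linf_norm_def by (intro esssup_mono) auto
  then have "0 \<le> Linf_norm \<psi>"
    by (simp add: esssup_const)
  moreover have "Linf_norm \<psi> < \<infinity>"
    using assms by (simp add: Linf_def)
  ultimately obtain K where K: "Linf_norm \<psi> = ereal K" "K \<ge> 0"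
    by (cases "Linf_norm \<psi>") auto
  have "AE t in lebesgue. ereal (norm (\<psi> t)) \<le> Linf_norm \<psi>"
    unfolding Linf_norm_def by (rule esssup_AE)
  then have "AE t in lebesgue. norm (\<psi> t) \<le> K"
    by (simp add: K)
  with K show ?thesis
    by (intro that)
qed

lemma LinfI:
  assumes [measurable]: "\<psi> \<in> borel_measurable lebesgue" and "AE t in lebesgue. norm (\<psi> t) \<le> K"
  shows "\<psi> \<in> Linf"
proof -
  have "Linf_norm \<psi> \<le> ereal K"
    unfolding Linf_norm_def using assms(2) by (intro esssup_I) auto
  also have "\<dots> < \<infinity>"
    by simp
  finally show ?thesis
    by (simp add: Linf_def)
qed

lemma Linf_add:
  assumes "\<psi> \<in> Linf" "\<eta> \<in> Linf"
  shows "(\<lambda>t. \<psi> t + \<eta> t) \<in> Linf"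
proof -
  obtain K where K: "AE t in lebesgue. norm (\<psi> t) \<le> K"
    using assms(1) by (rule Linf_normE)
  obtain L where L: "AE t in lebesgue. norm (\<eta> t) \<le> L"
    using assms(2) by (rule Linf_normE)
  have "AE t in lebesgue. norm (\<psi> t + \<eta> t) \<le> K + L"
    using K L by eventually_elim (rule norm_triangle_le, simp)
  then show ?thesis
    using assms by (intro LinfI) (auto simp: Linf_def)
qed

lemma Linf_cmult:
  assumes "\<psi> \<in> Linf"
  shows "(\<lambda>t. c * \<psi> t) \<in> Linf"
proof -
  obtain K where K: "AE t in lebesgue. norm (\<psi> t) \<le> K"
    using assms by (rule Linf_normE)
  have "AE t in lebesgue. norm (c * \<psi> t) \<le> norm c * K"
    using K by eventually_elim (simp add: norm_mult mult_left_mono)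
  then show ?thesis
    using assms by (intro LinfI) (auto simp: Linf_def)
qed

lemma poisson_average_integrable:
  assumes "\<psi> \<in> Linf" "Re z > 0"
  shows "integrable lebesgue (\<lambda>t. poisson_kernel (Re z) (Im z - t) *\<^sub>R \<psi> t)"
proof -
  obtain K where K: "AE t in lebesgue. norm (\<psi> t) \<le> K"
    using assms(1) by (rule Linf_normE)
  have [measurable]: "\<psi> \<in> borel_measurable lebesgue"
    using assms by (simp add: Linf_def)
  show ?thesis
  proof (rule Bochner_Integration.integrable_bound)
    show "integrable lebesgue (\<lambda>t. K * poisson_kernel (Re z) (Im z - t))"
      using assms(2) by (intro integrable_mult_right poisson_kernel_lebesgue)
    show "AE t in lebesgue. norm (poisson_kernel (Re z) (Im z - t) *\<^sub>R \<psi> t) \<le> norm (K * poisson_kernel (Re z) (Im z - t))"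
      using K
    proof eventually_elim
      case (elim t)
      then have "norm (\<psi> t) \<le> \<bar>K\<bar>"
        by simp
      then show ?case
        by (simp add: abs_mult mult.commute mult_right_mono)
    qed
  qed measurable
qed

lemma norm_poisson_average_le:
  assumes "\<psi> \<in> Linf" "Re z > 0" and K: "AE t in lebesgue. norm (\<psi> t) \<le> K"
  shows "norm (poisson_average z \<psi>) \<le> K"
proof -
  let ?p = "\<lambda>t. poisson_kernel (Re z) (Im z - t)"
  have p0: "?p t \<ge> 0" for t
    using assms(2) by (intro poisson_kernel_nonneg) simp
  have "norm (poisson_average z \<psi>) \<le> (LINT t|lebesgue. norm (?p t *\<^sub>R \<psi> t))"
    unfolding poisson_average_def by (rule integral_norm_bound)
  also have "\<dots> \<le> (LINT t|lebesgue. K * ?p t)"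
  proof (rule integral_mono_AE)
    show "integrable lebesgue (\<lambda>t. norm (?p t *\<^sub>R \<psi> t))"
      by (intro integrable_norm poisson_average_integrable assms)
    show "integrable lebesgue (\<lambda>t. K * ?p t)"
      using assms(2) by (intro integrable_mult_right poisson_kernel_lebesgue)
    show "AE t in lebesgue. norm (?p t *\<^sub>R \<psi> t) \<le> K * ?p t"
      using K by eventually_elim (use p0 in \<open>simp add: mult.commute mult_right_mono\<close>)
  qed
  also have "\<dots> = K"
    using poisson_kernel_lebesgue(2)[OF assms(2), of "Im z"] by simp
  finally show ?thesis .
qed

lemma poisson_average_add:
  assumes "\<psi> \<in> Linf" "\<eta> \<in> Linf" "Re z > 0"
  shows "poisson_average z (\<lambda>t. \<psi> t + \<eta> t) = poisson_average z \<psi> + poisson_average z \<eta>"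
  unfolding poisson_average_def scaleR_add_right
  by (intro Bochner_Integration.integral_add poisson_average_integrable assms)

lemma poisson_average_cmult: "poisson_average z (\<lambda>t. c * \<psi> t) = c * poisson_average z \<psi>"
  unfolding poisson_average_def by (simp flip: mult_scaleR_right)

lemma poisson_average_one:
  assumes "Re z > 0"
  shows "poisson_average z (\<lambda>_. 1) = 1"
  unfolding poisson_average_def
  using poisson_kernel_lebesgue[OF assms, of "Im z"] by simp

lemma poisson_average_nonneg:
  assumes "\<psi> \<in> Linf" "Re z > 0" "AE t in lebesgue. \<psi> t \<in> \<real>\<^sub>\<ge>\<^sub>0"
  shows "poisson_average z \<psi> \<in> \<real>\<^sub>\<ge>\<^sub>0"
proof -
  let ?p = "\<lambda>t. poisson_kernel (Re z) (Im z - t)"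
  have p0: "?p t \<ge> 0" for t
    using assms(2) by (intro poisson_kernel_nonneg) simp
  have int: "integrable lebesgue (\<lambda>t. ?p t *\<^sub>R \<psi> t)"
    by (intro poisson_average_integrable assms)
  have "AE t in lebesgue. 0 \<le> Re (?p t *\<^sub>R \<psi> t)"
    using assms(3) by eventually_elim (use p0 in \<open>auto simp: complex_nonneg_Reals_iff\<close>)
  then have "0 \<le> (LINT t|lebesgue. Re (?p t *\<^sub>R \<psi> t))"
    by (rule integral_nonneg_AE)
  moreover have "AE t in lebesgue. Im (?p t *\<^sub>R \<psi> t) = 0"
    using assms(3) by eventually_elim (auto simp: complex_nonneg_Reals_iff)
  then have "(LINT t|lebesgue. Im (?p t *\<^sub>R \<psi> t)) = 0"
    by (rule integral_eq_zero_AE)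
  ultimately show ?thesis
    unfolding poisson_average_def complex_nonneg_Reals_iff integral_Re[OF int, symmetric] integral_Im[OF int, symmetric]
    by simp
qed

section \<open>Boundary functions and their Poisson averages\<close>

lemma HinfD:
  assumes "\<phi> \<in> Hinf"
  shows "\<phi> holomorphic_on {w. Re w > 0}" "\<exists>M. \<forall>w. Re w > 0 \<longrightarrow> norm (\<phi> w) \<le> M"
  using assms by (auto simp: Hinf_def right_half_plane_def bounded_iff)

lemma boundary_function_AE_limit:
  assumes "\<phi> \<in> Hinf"
  shows "AE y in lebesgue. ((\<lambda>x. \<phi> (Complex x y)) \<longlongrightarrow> boundary_function \<phi> y) (at_right 0)"
proof -
  obtain M where "\<forall>w. Re w > 0 \<longrightarrow> norm (\<phi> w) \<le> M"
    using HinfD(2)[OF assms] by blast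
  then have \<phi>: "\<phi> holomorphic_on {w. Re w > 0}" "\<And>w. Re w > 0 \<Longrightarrow> norm (\<phi> w) \<le> M"
    using HinfD(1)[OF assms] by auto
  have "AE y in lebesgue. \<exists>l. ((\<lambda>x. \<phi> (Complex x y)) \<longlongrightarrow> l) (at_right 0)"
    by (rule AE_completion) (rule Fatou_AE_radial_limit[OF \<phi>])
  then show ?thesis
  proof eventually_elim
    case (elim y)
    then obtain l where l: "((\<lambda>x. \<phi> (Complex x y)) \<longlongrightarrow> l) (at_right 0)"
      by blast
    then have "boundary_function \<phi> y = l"
      unfolding boundary_function_def by (intro tendsto_Lim) auto
    with l show ?case
      by simp
  qed
qed

text \<open>The shifts w |-> \<open>\<phi>\<close> (w + d n) are analytic across the axis, so the
  Poisson formula applies to them. Their slices converge almost everywhere to the boundary function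
  and are dominated by M, so the formula passes to the limit.\<close>

lemma
  assumes "\<phi> \<in> Hinf"
  shows boundary_function_in_Linf: "boundary_function \<phi> \<in> Linf"
    and poisson_average_boundary_function: "Re z > 0 \<Longrightarrow> poisson_average z (boundary_function \<phi>) = \<phi> z"
proof -
  obtain M where "\<forall>w. Re w > 0 \<longrightarrow> norm (\<phi> w) \<le> M"
    using HinfD(2)[OF assms] by blast
  then have \<phi>: "\<phi> holomorphic_on {w. Re w > 0}" "\<And>w. Re w > 0 \<Longrightarrow> norm (\<phi> w) \<le> M"
    using HinfD(1)[OF assms] by auto
  have cont: "continuous_on {w. Re w > 0} \<phi>"
    using \<phi>(1) by (rule holomorphic_on_imp_continuous_on)
  define d where "d n = 1 / real (Suc n)" for n
  have d: "d n > 0" for n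
    by (simp add: d_def)
  have d_lim: "d \<longlonglongrightarrow> 0"
    unfolding d_def by real_asymp
  have d_right: "filterlim d (at_right 0) sequentially"
    using d_lim d by (auto simp: filterlim_at less_imp_neq[symmetric])
  have borel: "(\<lambda>y. \<phi> (Complex (d n) y)) \<in> borel_measurable borel" for n
    using d by (intro borel_measurable_continuous_onI continuous_on_vertical_line[OF cont]) auto
  have AE_lim: "AE y in lebesgue. (\<lambda>n. \<phi> (Complex (d n) y)) \<longlonglongrightarrow> boundary_function \<phi> y"
    using boundary_function_AE_limit[OF assms]
    by eventually_elim (rule filterlim_compose[OF _ d_right])
  have bmeas: "boundary_function \<phi> \<in> borel_measurable lebesgue"
  proof (rule borel_measurable_AE)
    \<comment> \<open>The sequential \<open>lim\<close> is Borel measurable everywhere; the boundary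
      function agrees with it almost everywhere, which suffices for a complete measure.\<close>
    have "(\<lambda>y. lim (\<lambda>n. \<phi> (Complex (d n) y))) \<in> borel_measurable lborel"
      using borel by (intro borel_measurable_lim_metric) simp
    then show "(\<lambda>y. lim (\<lambda>n. \<phi> (Complex (d n) y))) \<in> borel_measurable lebesgue"
      by (rule measurable_completion)
    show "AE y in lebesgue. lim (\<lambda>n. \<phi> (Complex (d n) y)) = boundary_function \<phi> y"
      using AE_lim by eventually_elim (rule limI)
  qed
  have bound: "AE y in lebesgue. norm (boundary_function \<phi> y) \<le> M"
    using AE_lim
  proof eventually_elim
    case (elim y)
    then show ?case
      using \<phi>(2) d by (intro tendsto_upperbound[OF tendsto_norm[OF elim]]) auto
  qed
  show "boundary_function \<phi> \<in> Linf"
    using bmeas bound by (rule LinfI)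
  assume z: "Re z > 0"
  let ?p = "\<lambda>t. poisson_kernel (Re z) (Im z - t)"
  have p0: "?p t \<ge> 0" for t
    using z by (intro poisson_kernel_nonneg) simp
  have approx: "(LINT t|lebesgue. ?p t *\<^sub>R \<phi> (Complex (d n) t)) = \<phi> (z + of_real (d n))" for n
  proof -
    have "(LINT t|lborel. ?p t *\<^sub>R \<phi> (Complex 0 t + of_real (d n))) = \<phi> (z + of_real (d n))"
    proof (rule poisson_formula[where d = "d n" and M = M])
      have "(\<phi> \<circ> (\<lambda>w. w + of_real (d n))) holomorphic_on {w. Re w > - d n}"
        by (intro holomorphic_on_compose_gen[OF _ \<phi>(1)] holomorphic_intros) auto
      then show "(\<lambda>w. \<phi> (w + of_real (d n))) holomorphic_on {w. Re w > - d n}"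
        by (simp add: o_def)
    qed (use d z \<phi>(2) in auto)
    moreover have "Complex 0 t + of_real (d n) = Complex (d n) t" for t
      by (simp add: complex_eq_iff)
    ultimately show ?thesis
      using borel[of n] by (simp add: integral_completion)
  qed
  have "(\<lambda>n. LINT t|lebesgue. ?p t *\<^sub>R \<phi> (Complex (d n) t)) \<longlonglongrightarrow> poisson_average z (boundary_function \<phi>)"
    unfolding poisson_average_def
  proof (rule integral_dominated_convergence[where w = "\<lambda>t. M * ?p t"])
    show "(\<lambda>t. ?p t *\<^sub>R boundary_function \<phi> t) \<in> borel_measurable lebesgue"
      using bmeas by measurable
    show "(\<lambda>t. ?p t *\<^sub>R \<phi> (Complex (d n) t)) \<in> borel_measurable lebesgue" for n
      using borel[of n] by (intro measurable_completion) simp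
    show "integrable lebesgue (\<lambda>t. M * ?p t)"
      using z by (intro integrable_mult_right poisson_kernel_lebesgue)
    show "AE t in lebesgue. (\<lambda>n. ?p t *\<^sub>R \<phi> (Complex (d n) t)) \<longlonglongrightarrow> ?p t *\<^sub>R boundary_function \<phi> t"
      using AE_lim by eventually_elim (intro tendsto_intros)
    show "AE t in lebesgue. norm (?p t *\<^sub>R \<phi> (Complex (d n) t)) \<le> M * ?p t" for n
      using \<phi>(2) d p0 by (intro AE_I2) (simp add: mult.commute mult_right_mono)
  qed
  moreover have "(\<lambda>n. \<phi> (z + of_real (d n))) \<longlonglongrightarrow> \<phi> z"
  proof (rule continuous_on_tendsto_compose[OF cont])
    show "(\<lambda>n. z + of_real (d n)) \<longlonglongrightarrow> z"
      using tendsto_add[OF tendsto_const[of z] tendsto_of_real[OF d_lim]] by simp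
  qed (use z d in \<open>auto intro!: always_eventually add_pos_pos\<close>)
  ultimately show "poisson_average z (boundary_function \<phi>) = \<phi> z"
    unfolding approx by (rule LIMSEQ_unique)
qed

section \<open>Asymptotic translation invariance\<close>

text \<open>In x^2 + (u + s)^2 the cross term 2 u s is at most |s| / x times x^2 + u^2, and s^2 is
  at most s^2 / x^2 times it: these are the two summands of c. Thus the two kernel values p (at t)
  and q (at t - s) differ at most by the factor 1 + c either way, and |q - p| is at most c max(p,
  q), hence at most c (1 + c) p. For fixed s, c tends to 0 as x grows.\<close>

lemma poisson_kernel_translate_le:
  fixes s t x :: real
  assumes x: "x > 0"
  defines "c \<equiv> \<bar>s\<bar> / x + s\<^sup>2 / x\<^sup>2"
  shows "\<bar>poisson_kernel x (t - s) - poisson_kernel x t\<bar> \<le> c * (1 + c) * poisson_kernel x t"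
proof -
  have c: "c \<ge> 0"
    using x by (simp add: c_def)
  have pos: "x\<^sup>2 + u\<^sup>2 > 0" for u :: real
    using x by (simp add: add_pos_nonneg)
  have key: "x\<^sup>2 + (u + s')\<^sup>2 \<le> (1 + c) * (x\<^sup>2 + u\<^sup>2)" if s': "\<bar>s'\<bar> = \<bar>s\<bar>" for u s' :: real
  proof -
    have "s'\<^sup>2 = s\<^sup>2"
      by (metis power2_abs s')
    have "2 * (x * \<bar>u\<bar>) \<le> x\<^sup>2 + u\<^sup>2"
      using zero_le_power2[of "x - \<bar>u\<bar>"] by (simp add: power2_diff)
    then have "\<bar>s\<bar> / x * (2 * (x * \<bar>u\<bar>)) \<le> \<bar>s\<bar> / x * (x\<^sup>2 + u\<^sup>2)"
      using x by (intro mult_left_mono) auto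
    then have "2 * (\<bar>u\<bar> * \<bar>s'\<bar>) \<le> \<bar>s\<bar> / x * (x\<^sup>2 + u\<^sup>2)"
      using x s' by (simp add: mult_ac)
    moreover have "u * s' \<le> \<bar>u\<bar> * \<bar>s'\<bar>"
      by (metis abs_ge_self abs_mult)
    moreover have "s\<^sup>2 / x\<^sup>2 * x\<^sup>2 \<le> s\<^sup>2 / x\<^sup>2 * (x\<^sup>2 + u\<^sup>2)"
      by (intro mult_left_mono) auto
    then have "s\<^sup>2 \<le> s\<^sup>2 / x\<^sup>2 * (x\<^sup>2 + u\<^sup>2)"
      using x by simp
    moreover have "(u + s')\<^sup>2 = u\<^sup>2 + 2 * (u * s') + s\<^sup>2"
      by (simp add: power2_sum \<open>s'\<^sup>2 = s\<^sup>2\<close>)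
    ultimately show ?thesis
      by (simp add: c_def distrib_right)
  qed
  have ratio: "poisson_kernel x u \<le> (1 + c) * poisson_kernel x (u + s')" if s': "\<bar>s'\<bar> = \<bar>s\<bar>" for u s' :: real
  proof -
    have "x * (x\<^sup>2 + (u + s')\<^sup>2) \<le> x * ((1 + c) * (x\<^sup>2 + u\<^sup>2))"
      using x key[OF s', of u] by (intro mult_left_mono) auto
    then have "x / (x\<^sup>2 + u\<^sup>2) \<le> (1 + c) * x / (x\<^sup>2 + (u + s')\<^sup>2)"
      using pos[of u] pos[of "u + s'"] by (simp add: pos_divide_le_eq pos_le_divide_eq mult_ac)
    from divide_right_mono[OF this, of pi] show ?thesis
      by (simp add: poisson_kernel_def mult.commute)
  qed
  define p q where "p = poisson_kernel x t" and "q = poisson_kernel x (t - s)"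
  have "q \<le> (1 + c) * p" "p \<le> (1 + c) * q"
    using ratio[of s "t - s"] ratio[of "- s" t] by (simp_all add: p_def q_def)
  moreover have "p \<ge> 0"
    using x by (simp add: p_def poisson_kernel_nonneg)
  moreover have "c * q \<le> c * ((1 + c) * p)"
    using c \<open>q \<le> (1 + c) * p\<close> by (rule mult_left_mono[rotated])
  moreover have "0 \<le> c * (c * p)"
    using c \<open>p \<ge> 0\<close> by simp
  ultimately have "\<bar>q - p\<bar> \<le> c * ((1 + c) * p)"
    by (simp add: abs_le_iff algebra_simps)
  then show ?thesis
    by (simp add: p_def q_def mult.assoc)
qed

section \<open>Borel representatives, as needed for Fubini\<close>

lemma Linf_borel_representative:
  assumes "\<psi> \<in> Linf"
  obtains \<psi>' K where "\<psi>' \<in> borel_measurable borel" "\<And>t. norm (\<psi>' t) \<le> K" "K \<ge> 0"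
    "AE t in lborel. \<psi> t = \<psi>' t"
proof -
  have meas: "\<psi> \<in> borel_measurable lebesgue"
    using assms by (simp add: Linf_def)
  then have "(\<lambda>t. Re (\<psi> t)) \<in> borel_measurable lebesgue" "(\<lambda>t. Im (\<psi> t)) \<in> borel_measurable lebesgue"
    by simp_all
  then obtain a b where [measurable]: "a \<in> borel_measurable lborel" "b \<in> borel_measurable lborel"
    and ab: "AE t in lborel. Re (\<psi> t) = a t" "AE t in lborel. Im (\<psi> t) = b t"
    using completion_ex_borel_measurable_real by metis
  obtain K where K: "K \<ge> 0" "AE t in lebesgue. norm (\<psi> t) \<le> K"
    using assms by (rule Linf_normE)
  have K': "AE t in lborel. norm (\<psi> t) \<le> K"
    using K(2) by (simp add: AE_completion_iff)
  define h where "h t = of_real (a t) + \<i> * of_real (b t)" for t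
  have [measurable]: "h \<in> borel_measurable borel"
    unfolding h_def by measurable
  \<comment> \<open>Truncation turns the almost everywhere bound into a bound at every
    point.\<close>
  define \<psi>' where "\<psi>' t = (if norm (h t) \<le> K then h t else 0)" for t
  show ?thesis
  proof
    show "\<psi>' \<in> borel_measurable borel"
      unfolding \<psi>'_def by measurable
    show "norm (\<psi>' t) \<le> K" for t
      using K(1) by (simp add: \<psi>'_def)
    show "AE t in lborel. \<psi> t = \<psi>' t"
      using ab K'
    proof eventually_elim
      case (elim t)
      then have "h t = \<psi> t"
        by (simp add: h_def complex_eq_iff)
      with elim show ?case
        by (simp add: \<psi>'_def)
    qed
  qed (rule K(1))
qed

lemma probability_density_borel_representative:
  assumes "f \<in> probability_densities"
  obtains g where "g \<in> borel_measurable borel" "\<And>t. g t \<ge> 0" "integrable lborel g" "integral\<^sup>L lborel g = 1"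
    "AE t in lborel. f t = g t"
proof -
  have f: "integrable lebesgue f" "AE t in lebesgue. 0 \<le> f t" "(LINT t|lebesgue. f t) = 1"
    using assms by (auto simp: probability_densities_def)
  have meas: "f \<in> borel_measurable lebesgue"
    using f(1) by (rule borel_measurable_integrable)
  then obtain g where [measurable]: "g \<in> borel_measurable lborel" and g: "AE t in lborel. f t = g t"
    using completion_ex_borel_measurable_real by metis
  have f0: "AE t in lborel. 0 \<le> f t"
    using f(2) by (simp add: AE_completion_iff)
  define h where "h t = max 0 (g t)" for t
  have h: "h \<in> borel_measurable borel"
    unfolding h_def by measurable
  have fh: "AE t in lborel. f t = h t"
    using g f0 by eventually_elim (simp add: h_def)
  have h': "h \<in> borel_measurable lebesgue"
    using h by (intro measurable_completion) simp
  have "integrable lebesgue h" "integral\<^sup>L lebesgue h = 1"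
    using f(1,3) integrable_cong_AE[OF meas h' AE_completion[OF fh]]
      integral_cong_AE[OF meas h' AE_completion[OF fh]] by auto
  then have "integrable lborel h" "integral\<^sup>L lborel h = 1"
    using h by (simp_all add: integrable_completion integral_completion)
  moreover have "h t \<ge> 0" for t
    by (simp add: h_def)
  ultimately show ?thesis
    using that[OF h _ _ _ fh] by blast
qed

text \<open>The map t |-> x - t preserves null sets, so for each single x the integrand changes only
  on a null set. The equality therefore holds at every x, not merely at almost every x.\<close>

lemma convolution_cong_AE:
  assumes f: "AE t in lborel. f t = f' t" and \<psi>: "AE t in lborel. \<psi> t = \<psi>' t"
    and meas: "f' \<in> borel_measurable borel" "\<psi>' \<in> borel_measurable borel"
  shows "Defs.convolution f \<psi> x = (LINT t|lborel. \<psi>' (x - t) * of_real (f' t))"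
proof -
  obtain N where N: "N \<in> sets lborel" "{t. \<psi> t \<noteq> \<psi>' t} \<subseteq> N" "emeasure lborel N = 0"
    using \<psi> by (auto elim!: AE_E)
  have "AE t in lborel. t \<notin> N"
    using N by (intro AE_not_in) auto
  then have "AE t in lborel. x + (-1) * t \<notin> N"
    using N(1) by (intro AE_borel_affine[where P = "\<lambda>t. t \<notin> N"]) auto
  then have "AE t in lborel. \<psi>' (x - t) * of_real (f' t) = \<psi> (x - t) * of_real (f t)"
    using f
  proof eventually_elim
    case (elim t)
    then have "x - t \<notin> N"
      by simp
    then have "\<psi> (x - t) = \<psi>' (x - t)"
      using N(2) by blast
    with elim show ?case
      by simp
  qed
  then have AE: "AE t in lebesgue. \<psi>' (x - t) * of_real (f' t) = \<psi> (x - t) * of_real (f t)"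
    by (rule AE_completion)
  have borel: "(\<lambda>t. \<psi>' (x - t) * of_real (f' t)) \<in> borel_measurable lborel"
    using meas by measurable
  then have leb: "(\<lambda>t. \<psi>' (x - t) * of_real (f' t)) \<in> borel_measurable lebesgue"
    by (rule measurable_completion)
  have "Defs.convolution f \<psi> x = (LINT t|lebesgue. \<psi>' (x - t) * of_real (f' t))"
    unfolding Defs.convolution_def
    by (rule integral_cong_AE[symmetric, OF leb borel_measurable_AE[OF leb AE] AE])
  also have "\<dots> = (LINT t|lborel. \<psi>' (x - t) * of_real (f' t))"
    using borel by (rule integral_completion)
  finally show ?thesis .
qed

lemma integrable_tensor_lborel:
  fixes g :: "real \<Rightarrow> real" and h :: "real \<Rightarrow> real"
  assumes "integrable lborel g" "integrable lborel h" "\<And>t. g t \<ge> 0" "\<And>t. h t \<ge> 0"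
  shows "integrable (lborel \<Otimes>\<^sub>M lborel) (\<lambda>(u, s). g u * h s)"
proof (rule lborel_pair.Fubini_integrable)
  have [measurable]: "g \<in> borel_measurable borel" "h \<in> borel_measurable borel"
    using assms(1,2)[THEN borel_measurable_integrable] by simp_all
  show "(\<lambda>(u, s). g u * h s) \<in> borel_measurable (lborel \<Otimes>\<^sub>M lborel)"
    by measurable
  show "integrable lborel (\<lambda>u. LINT s|lborel. norm (case (u, s) of (u, s) \<Rightarrow> g u * h s))"
    using assms by (simp add: abs_mult)
  show "AE u in lborel. integrable lborel (\<lambda>s. case (u, s) of (u, s) \<Rightarrow> g u * h s)"
    using assms by simp
qed

text \<open>Fubini turns $P_z(f * \psi) - P_z \psi$ into an average, weighted by $f(s)$, of the
  differences between $\psi$ averaged against the kernel translated by $s$ and against the kernel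
  itself.\<close>
lemma poisson_average_convolution_diff:
  fixes \<psi> :: "real \<Rightarrow> complex"
  assumes g: "g \<in> borel_measurable borel" "\<And>t. g t \<ge> 0" "integrable lborel g" "integral\<^sup>L lborel g = 1"
    and \<psi>: "\<psi> \<in> borel_measurable borel" "\<And>t. norm (\<psi> t) \<le> K" and K: "K \<ge> 0" and x: "x > 0"
  shows "norm ((LINT u|lborel. poisson_kernel x (y - u) *\<^sub>R (LINT s|lborel. \<psi> (u - s) * of_real (g s)))
      - (LINT u|lborel. poisson_kernel x (y - u) *\<^sub>R \<psi> u))
    \<le> K * (LINT s|lborel. g s * min 2 ((\<bar>s\<bar> / x + s\<^sup>2 / x\<^sup>2) * (1 + (\<bar>s\<bar> / x + s\<^sup>2 / x\<^sup>2))))"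
proof -
  note [measurable] = g(1) \<psi>(1)
  let ?p = "\<lambda>t. poisson_kernel x (y - t)"
  \<comment> \<open>Two bounds in one: the kernel translation estimate, good when s is small against
    x, and the trivial bound 2. The cap keeps \<open>g s * ?\<omega> s\<close> integrable even when
    g has no finite moments.\<close>
  let ?\<omega> = "\<lambda>s. min 2 ((\<bar>s\<bar> / x + s\<^sup>2 / x\<^sup>2) * (1 + (\<bar>s\<bar> / x + s\<^sup>2 / x\<^sup>2)))"
  have p: "integrable lborel (\<lambda>t. poisson_kernel x (w - t))" "(LINT t|lborel. poisson_kernel x (w - t)) = 1" for w
    using poisson_kernel_has_integral[OF x, of w] by (auto simp: has_bochner_integral_iff)
  have p0: "poisson_kernel x w \<ge> 0" for w
    using x by (intro poisson_kernel_nonneg) simp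
  \<comment> \<open>Translating \<open>\<psi>\<close> by s is moved onto the kernel:
    \<open>Q s\<close> is the average with centre y - s, and the convolution becomes the g-weighted
    mean of \<open>Q\<close>.\<close>
  define Q where "Q s = (LINT v|lborel. poisson_kernel x (y - s - v) *\<^sub>R \<psi> v)" for s
  have intQ: "integrable lborel (\<lambda>v. poisson_kernel x (w - v) *\<^sub>R \<psi> v)" for w
  proof (rule Bochner_Integration.integrable_bound[OF integrable_mult_right[OF p(1)[of w], of K]])
    show "AE v in lborel. norm (poisson_kernel x (w - v) *\<^sub>R \<psi> v) \<le> norm (K * poisson_kernel x (w - v))"
      using \<psi>(2) p0 K by (intro AE_I2) (simp add: abs_mult mult.commute mult_right_mono)
  qed measurable
  have [measurable]: "Q \<in> borel_measurable borel"
    unfolding Q_def[abs_def] by measurable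
  have Q_diff: "norm (Q s - Q 0) \<le> K * ?\<omega> s" for s
  proof -
    have Q_bound: "norm (Q s) \<le> K" for s
      unfolding Q_def
      by (rule norm_integral_le_poisson[OF x, where y = "y - s"])
        (use \<psi>(2) p0 in \<open>simp add: mult.commute mult_right_mono\<close>)
    define c where "c = (\<bar>s\<bar> / x + s\<^sup>2 / x\<^sup>2) * (1 + (\<bar>s\<bar> / x + s\<^sup>2 / x\<^sup>2))"
    have "Q s - Q 0 = (LINT v|lborel. poisson_kernel x (y - s - v) *\<^sub>R \<psi> v - poisson_kernel x (y - v) *\<^sub>R \<psi> v)"
      unfolding Q_def using intQ[of "y - s"] intQ[of y] by (subst Bochner_Integration.integral_diff) simp_all
    also have "norm \<dots> \<le> K * c"
    proof (rule norm_integral_le_poisson[OF x, where y = y])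
      fix v
      have "norm (poisson_kernel x (y - s - v) *\<^sub>R \<psi> v - poisson_kernel x (y - v) *\<^sub>R \<psi> v)
          = \<bar>poisson_kernel x (y - v - s) - poisson_kernel x (y - v)\<bar> * norm (\<psi> v)"
        by (simp add: algebra_simps flip: scaleR_diff_left)
      also have "\<dots> \<le> (c * poisson_kernel x (y - v)) * K"
        using poisson_kernel_translate_le[OF x, of "y - v" s] \<psi>(2) p0 x
        unfolding c_def by (intro mult_mono) auto
      finally show "norm (poisson_kernel x (y - s - v) *\<^sub>R \<psi> v - poisson_kernel x (y - v) *\<^sub>R \<psi> v)
          \<le> K * c * poisson_kernel x (y - v)"
        by (simp add: mult_ac)
    qed
    finally have "norm (Q s - Q 0) \<le> K * c" .
    moreover have "norm (Q s - Q 0) \<le> K * 2"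
      using norm_triangle_ineq4[of "Q s" "Q 0"] Q_bound[of s] Q_bound[of 0] by linarith
    ultimately show ?thesis
      unfolding c_def by (simp add: min_def)
  qed
  have "(LINT u|lborel. ?p u *\<^sub>R (LINT s|lborel. \<psi> (u - s) * of_real (g s)))
      = (LINT u|lborel. (LINT s|lborel. ?p u *\<^sub>R (\<psi> (u - s) * of_real (g s))))"
    by simp
  also have "\<dots> = (LINT s|lborel. (LINT u|lborel. ?p u *\<^sub>R (\<psi> (u - s) * of_real (g s))))"
  proof (rule lborel_pair.Fubini_integral[symmetric])
    show "integrable (lborel \<Otimes>\<^sub>M lborel) (\<lambda>(u, s). ?p u *\<^sub>R (\<psi> (u - s) * of_real (g s)))"
    proof (rule Bochner_Integration.integrable_bound)
      show "integrable (lborel \<Otimes>\<^sub>M lborel) (\<lambda>(u, s). (K * ?p u) * g s)"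
        by (rule integrable_tensor_lborel) (use p g p0 K in auto)
      show "AE us in lborel \<Otimes>\<^sub>M lborel. norm (case us of (u, s) \<Rightarrow> ?p u *\<^sub>R (\<psi> (u - s) * of_real (g s)))
          \<le> norm (case us of (u, s) \<Rightarrow> (K * ?p u) * g s)"
      proof (intro AE_I2, clarify)
        fix u s
        have "?p u * (norm (\<psi> (u - s)) * g s) \<le> ?p u * (K * g s)"
          by (intro mult_left_mono mult_right_mono \<psi>(2) p0 g(2))
        then show "norm (?p u *\<^sub>R (\<psi> (u - s) * of_real (g s))) \<le> norm ((K * ?p u) * g s)"
          using p0 g(2) K by (simp add: norm_mult abs_mult mult_ac)
      qed
    qed measurable
  qed
  also have "\<dots> = (LINT s|lborel. g s *\<^sub>R Q s)"
  proof (rule Bochner_Integration.integral_cong[OF refl])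
    fix s
    have "(LINT u|lborel. ?p u *\<^sub>R (\<psi> (u - s) * of_real (g s)))
        = (LINT u|lborel. g s *\<^sub>R (?p u *\<^sub>R \<psi> (u - s)))"
      by (simp add: scaleR_conv_of_real mult_ac)
    also have "\<dots> = g s *\<^sub>R (LINT u|lborel. ?p u *\<^sub>R \<psi> (u - s))"
      by (simp only: integral_scaleR_right)
    also have "(LINT u|lborel. ?p u *\<^sub>R \<psi> (u - s)) = Q s"
      unfolding Q_def by (subst lborel_integral_real_affine[where c = 1 and t = s]) (simp_all add: algebra_simps)
    finally show "(LINT u|lborel. ?p u *\<^sub>R (\<psi> (u - s) * of_real (g s))) = g s *\<^sub>R Q s" .
  qed
  finally have conv: "(LINT u|lborel. ?p u *\<^sub>R (LINT s|lborel. \<psi> (u - s) * of_real (g s)))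
      = (LINT s|lborel. g s *\<^sub>R Q s)" .
  have int\<omega>: "integrable lborel (\<lambda>s. g s * ?\<omega> s)"
  proof (rule Bochner_Integration.integrable_bound[OF integrable_mult_right[OF g(3), of 2]])
    show "AE s in lborel. norm (g s * ?\<omega> s) \<le> norm (2 * g s)"
    proof (intro AE_I2)
      fix s
      have "0 \<le> ?\<omega> s" "?\<omega> s \<le> 2"
        using x by simp_all
      then have "g s * ?\<omega> s \<le> g s * 2" "0 \<le> g s * ?\<omega> s"
        using g(2)[of s] by (auto intro: mult_left_mono mult_nonneg_nonneg)
      then show "norm (g s * ?\<omega> s) \<le> norm (2 * g s)"
        using g(2)[of s] unfolding real_norm_def by linarith
    qed
  qed measurable
  have int_gQ0: "integrable lborel (\<lambda>s. g s *\<^sub>R Q 0)"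
    using g(3) by simp
  have g_diff: "norm (g s *\<^sub>R Q s - g s *\<^sub>R Q 0) \<le> K * (g s * ?\<omega> s)" for s
  proof -
    have "norm (g s *\<^sub>R Q s - g s *\<^sub>R Q 0) = g s * norm (Q s - Q 0)"
      using g(2)[of s] by (simp flip: scaleR_diff_right)
    also have "\<dots> \<le> g s * (K * ?\<omega> s)"
      by (intro mult_left_mono Q_diff g(2))
    finally show ?thesis
      by (simp only: mult.left_commute)
  qed
  have int_diff: "integrable lborel (\<lambda>s. g s *\<^sub>R Q s - g s *\<^sub>R Q 0)"
  proof (rule Bochner_Integration.integrable_bound[OF integrable_mult_right[OF int\<omega>, of K]])
    show "AE s in lborel. norm (g s *\<^sub>R Q s - g s *\<^sub>R Q 0) \<le> norm (K * (g s * ?\<omega> s))"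
      by (intro AE_I2 order_trans[OF g_diff]) (simp only: real_norm_def abs_ge_self)
  qed measurable
  have int_gQ: "integrable lborel (\<lambda>s. g s *\<^sub>R Q s)"
    using Bochner_Integration.integrable_add[OF int_diff int_gQ0] by simp
  \<comment> \<open>As g has mass 1, the unconvolved average is the g-weighted mean of the constant
    \<open>Q 0\<close>.\<close>
  have "(LINT u|lborel. ?p u *\<^sub>R \<psi> u) = (LINT s|lborel. g s *\<^sub>R Q 0)"
    using g(3,4) by (simp add: Q_def)
  then have "(LINT u|lborel. ?p u *\<^sub>R (LINT s|lborel. \<psi> (u - s) * of_real (g s))) - (LINT u|lborel. ?p u *\<^sub>R \<psi> u)
      = (LINT s|lborel. g s *\<^sub>R Q s - g s *\<^sub>R Q 0)"
    unfolding conv by (simp only: Bochner_Integration.integral_diff[OF int_gQ int_gQ0])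
  also have "norm \<dots> \<le> (LINT s|lborel. norm (g s *\<^sub>R Q s - g s *\<^sub>R Q 0))"
    by (rule integral_norm_bound)
  also have "\<dots> \<le> (LINT s|lborel. K * (g s * ?\<omega> s))"
    using int_diff int\<omega> by (intro integral_mono integrable_norm integrable_mult_right g_diff)
  also have "\<dots> = K * (LINT s|lborel. g s * ?\<omega> s)"
    by (rule integral_mult_right_zero)
  finally show ?thesis .
qed

text \<open>Dominated convergence: the weight tends to 0 for each fixed s, and the cap 2 supplies
  the majorant 2 |g|.\<close>

lemma dilated_weight_tendsto_0:
  assumes g: "g \<in> borel_measurable borel" "integrable lborel (g :: real \<Rightarrow> real)"
  shows "((\<lambda>x. LINT s|lborel. g s * min 2 ((\<bar>s\<bar> / x + s\<^sup>2 / x\<^sup>2) * (1 + (\<bar>s\<bar> / x + s\<^sup>2 / x\<^sup>2)))) \<longlongrightarrow> 0) at_top"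
proof -
  note [measurable] = g(1)
  have "((\<lambda>x. LINT s|lborel. g s * min 2 ((\<bar>s\<bar> / x + s\<^sup>2 / x\<^sup>2) * (1 + (\<bar>s\<bar> / x + s\<^sup>2 / x\<^sup>2)))) \<longlongrightarrow> (LINT s::real|lborel. 0)) at_top"
  proof (rule integral_dominated_convergence_at_top[where w = "\<lambda>s. 2 * \<bar>g s\<bar>" and f = "\<lambda>_. 0"])
    show "integrable lborel (\<lambda>s. 2 * \<bar>g s\<bar>)"
      using g by (intro integrable_mult_right integrable_abs)
    show "AE s in lborel. ((\<lambda>x. g s * min 2 ((\<bar>s\<bar> / x + s\<^sup>2 / x\<^sup>2) * (1 + (\<bar>s\<bar> / x + s\<^sup>2 / x\<^sup>2)))) \<longlongrightarrow> 0) at_top"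
    proof (intro AE_I2)
      fix s :: real
      have "((\<lambda>x. (\<bar>s\<bar> / x + s\<^sup>2 / x\<^sup>2) * (1 + (\<bar>s\<bar> / x + s\<^sup>2 / x\<^sup>2))) \<longlongrightarrow> 0) at_top"
        by real_asymp
      then have "((\<lambda>x. g s * min 2 ((\<bar>s\<bar> / x + s\<^sup>2 / x\<^sup>2) * (1 + (\<bar>s\<bar> / x + s\<^sup>2 / x\<^sup>2)))) \<longlongrightarrow> g s * min 2 0) at_top"
        by (intro tendsto_intros)
      then show "((\<lambda>x. g s * min 2 ((\<bar>s\<bar> / x + s\<^sup>2 / x\<^sup>2) * (1 + (\<bar>s\<bar> / x + s\<^sup>2 / x\<^sup>2)))) \<longlongrightarrow> 0) at_top"
        by simp
    qed
    show "\<forall>\<^sub>F x in at_top. AE s in lborel. norm (g s * min 2 ((\<bar>s\<bar> / x + s\<^sup>2 / x\<^sup>2) * (1 + (\<bar>s\<bar> / x + s\<^sup>2 / x\<^sup>2)))) \<le> 2 * \<bar>g s\<bar>"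
      using eventually_gt_at_top[of 0]
    proof (eventually_elim, intro AE_I2)
      fix x s :: real assume x: "x > 0"
      have "\<bar>min 2 ((\<bar>s\<bar> / x + s\<^sup>2 / x\<^sup>2) * (1 + (\<bar>s\<bar> / x + s\<^sup>2 / x\<^sup>2)))\<bar> \<le> 2"
        using x by (simp add: abs_le_iff min_le_iff_disj add_nonneg_nonneg)
      from mult_left_mono[OF this abs_ge_zero[of "g s"]]
      show "norm (g s * min 2 ((\<bar>s\<bar> / x + s\<^sup>2 / x\<^sup>2) * (1 + (\<bar>s\<bar> / x + s\<^sup>2 / x\<^sup>2)))) \<le> 2 * \<bar>g s\<bar>"
        by (simp only: real_norm_def abs_mult mult.commute)
    qed
  qed measurable
  then show ?thesis
    by simp
qed

text \<open>The difference estimate depends on z only through Re z, so it suffices that Re tends to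
  infinity along F, however Im behaves. Everything is computed on Borel representatives, which
  changes neither the convolution nor the Poisson average.\<close>

lemma
  assumes f: "f \<in> probability_densities" and \<psi>: "\<psi> \<in> Linf"
  shows convolution_in_Linf: "Defs.convolution f \<psi> \<in> Linf"
    and poisson_average_convolution_tendsto: "filterlim Re at_top F \<Longrightarrow>
      ((\<lambda>z. poisson_average z (Defs.convolution f \<psi>) - poisson_average z \<psi>) \<longlongrightarrow> 0) F"
proof -
  obtain \<psi>' K where \<psi>': "\<psi>' \<in> borel_measurable borel" "\<And>t. norm (\<psi>' t) \<le> K" and K: "K \<ge> 0"
    and AE\<psi>: "AE t in lborel. \<psi> t = \<psi>' t"
    using Linf_borel_representative[OF \<psi>] by metis
  obtain g where g: "g \<in> borel_measurable borel" "\<And>t. g t \<ge> 0" "integrable lborel g" "integral\<^sup>L lborel g = 1"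
    and AEf: "AE t in lborel. f t = g t"
    using probability_density_borel_representative[OF f] by metis
  note [measurable] = g(1) \<psi>'(1)
  have conv: "Defs.convolution f \<psi> = (\<lambda>u. LINT s|lborel. \<psi>' (u - s) * of_real (g s))"
    by (rule ext) (rule convolution_cong_AE[OF AEf AE\<psi> g(1) \<psi>'(1)])
  have borel: "Defs.convolution f \<psi> \<in> borel_measurable lborel"
    unfolding conv by measurable
  have "norm (Defs.convolution f \<psi> u) \<le> K" for u
  proof -
    have "norm (Defs.convolution f \<psi> u) \<le> (LINT s|lborel. norm (\<psi>' (u - s) * of_real (g s)))"
      unfolding conv by (rule integral_norm_bound)
    also have "\<dots> \<le> (LINT s|lborel. K * g s)"
    proof (rule integral_mono_AE')
      show "AE s in lborel. norm (\<psi>' (u - s) * of_real (g s)) \<le> K * g s"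
        using \<psi>'(2) g(2) by (intro AE_I2) (simp add: norm_mult mult_right_mono)
    qed (use g K in auto)
    also have "\<dots> = K"
      using g by simp
    finally show ?thesis .
  qed
  then show "Defs.convolution f \<psi> \<in> Linf"
    using measurable_completion[OF borel] by (intro LinfI[of _ K]) auto
  define W where "W x = (LINT s|lborel. g s * min 2 ((\<bar>s\<bar> / x + s\<^sup>2 / x\<^sup>2) * (1 + (\<bar>s\<bar> / x + s\<^sup>2 / x\<^sup>2))))" for x
  have bound: "norm (poisson_average z (Defs.convolution f \<psi>) - poisson_average z \<psi>) \<le> K * W (Re z)" if z: "Re z > 0" for z
  proof -
    let ?p = "\<lambda>t. poisson_kernel (Re z) (Im z - t)"
    have "poisson_average z (Defs.convolution f \<psi>) = (LINT u|lborel. ?p u *\<^sub>R Defs.convolution f \<psi> u)"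
      unfolding poisson_average_def using borel by (intro integral_completion) simp
    moreover have "poisson_average z \<psi> = (LINT u|lborel. ?p u *\<^sub>R \<psi>' u)"
    proof -
      have [measurable]: "\<psi> \<in> borel_measurable lebesgue"
        using \<psi> by (simp add: Linf_def)
      have "poisson_average z \<psi> = (LINT u|lebesgue. ?p u *\<^sub>R \<psi>' u)"
        unfolding poisson_average_def
      proof (rule integral_cong_AE)
        show "AE u in lebesgue. ?p u *\<^sub>R \<psi> u = ?p u *\<^sub>R \<psi>' u"
          using AE_completion[OF AE\<psi>] by eventually_elim simp
        show "(\<lambda>u. ?p u *\<^sub>R \<psi>' u) \<in> borel_measurable lebesgue"
          by (intro measurable_completion) simp
      qed measurable
      then show ?thesis
        by (simp add: integral_completion)
    qed
    ultimately show ?thesis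
      unfolding W_def using poisson_average_convolution_diff[OF g \<psi>' K z, of "Im z"] by (simp only: conv)
  qed
  assume F: "filterlim Re at_top F"
  show "((\<lambda>z. poisson_average z (Defs.convolution f \<psi>) - poisson_average z \<psi>) \<longlongrightarrow> 0) F"
  proof (rule Lim_null_comparison)
    show "\<forall>\<^sub>F z in F. norm (poisson_average z (Defs.convolution f \<psi>) - poisson_average z \<psi>) \<le> K * W (Re z)"
      using filterlim_at_top_dense[THEN iffD1, OF F, rule_format, of 0] by eventually_elim (rule bound)
    have "(W \<longlongrightarrow> 0) at_top"
      unfolding W_def by (rule dilated_weight_tendsto_0[OF g(1,3)])
    from tendsto_mult_right_zero[OF filterlim_compose[OF this F]]
    show "((\<lambda>z. K * W (Re z)) \<longlongrightarrow> 0) F" .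
  qed
qed

section \<open>The invariant mean\<close>

text \<open>Tychonoff's theorem replaces the choice of an ultrafilter: a cluster point in the product of
  discs is a pointwise limit along a finer filter.\<close>
lemma pointwise_limit_along_finer_filter:
  fixes T :: "'z \<Rightarrow> 'i \<Rightarrow> complex"
  assumes F: "F \<noteq> bot" and T: "\<And>z i. norm (T z i) \<le> B i"
  obtains G L where "G \<noteq> bot" "G \<le> F" "\<And>i. ((\<lambda>z. T z i) \<longlongrightarrow> L i) G"
proof -
  define U where "U = PiE UNIV (\<lambda>i. cball (0 :: complex) (B i))"
  have "compactin (product_topology (\<lambda>i. euclidean) UNIV) U"
    unfolding U_def compactin_PiE by simp
  then have "compact U"
    by (simp add: euclidean_product_topology)
  moreover have "\<forall>\<^sub>F w in filtermap T F. w \<in> U"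
    using T by (simp add: eventually_filtermap U_def PiE_iff)
  moreover have "filtermap T F \<noteq> bot"
    using F by (simp add: filtermap_bot_iff)
  ultimately obtain L where L: "inf (nhds L) (filtermap T F) \<noteq> bot"
    unfolding compact_filter by blast
  \<comment> \<open>The filter of those z in F whose values T z approach L. It is proper because L
    is a cluster point of the image filter.\<close>
  define G where "G = inf (filtercomap T (nhds L)) F"
  show ?thesis
  proof
    show "G \<noteq> bot"
    proof
      assume "G = bot"
      then have "eventually (\<lambda>_. False) G"
        by simp
      then obtain P Q where PQ: "eventually P (nhds L)" "eventually Q F" "\<And>z. P (T z) \<Longrightarrow> Q z \<Longrightarrow> False"
        unfolding G_def eventually_inf eventually_filtercomap by blast
      have "eventually (\<lambda>w. \<not> P w) (filtermap T F)"
        unfolding eventually_filtermap using PQ(2) by eventually_elim (use PQ(3) in blast)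
      then have "eventually (\<lambda>_. False) (inf (nhds L) (filtermap T F))"
        unfolding eventually_inf using PQ(1) by blast
      then show False
        using L by (simp add: eventually_False)
    qed
    show "G \<le> F"
      by (simp add: G_def)
    have T_lim: "filterlim T (nhds L) G"
      unfolding G_def by (intro filterlim_mono[OF filterlim_filtercomap order_refl]) simp
    show "((\<lambda>z. T z i) \<longlongrightarrow> L i) G" for i
    proof (rule topological_tendstoI)
      fix S assume S: "open S" "L i \<in> S"
      have "open ((\<lambda>w. w i) -` S :: ('i \<Rightarrow> complex) set)"
        using S(1) continuous_on_product_coordinates by (rule open_vimage)
      then have "\<forall>\<^sub>F w in nhds L. w \<in> (\<lambda>w. w i) -` S"
        using S(2) by (intro eventually_nhds_in_open) auto
      from eventually_compose_filterlim[OF this T_lim] show "\<forall>\<^sub>F z in G. T z i \<in> S"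
        by simp
    qed
  qed
qed

theorem theorem4p3:
  fixes \<theta> :: "(complex \<Rightarrow> complex) \<Rightarrow> complex"
  assumes "\<theta> \<in> maximal_ideals_at_infinity"
  shows "\<exists>\<Phi>. topologically_invariant_mean \<Phi> \<and>
           (\<forall>\<phi>\<in>Hinf. \<Phi> (boundary_function \<phi>) = \<theta> \<phi>)"
proof -
  obtain F where F: "F \<noteq> bot" "\<forall>\<^sub>F z in F. z \<in> right_half_plane" "filterlim Re at_top F"
    and lim: "limitin weak_star_topology evaluation \<theta> F"
    using assms by (auto simp: maximal_ideals_at_infinity_def)
  \<comment> \<open>Set to 0 off \<open>Linf\<close> and off the half plane, since the compactness
    lemma wants a bound for every z and every index; along G it is eventually the Poisson
    average.\<close>
  define T where "T z \<psi> = (if \<psi> \<in> Linf \<and> Re z > 0 then poisson_average z \<psi> else 0)" for z \<psi>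
  have norm_T: "norm (T z \<psi>) \<le> (if \<psi> \<in> Linf then real_of_ereal (Linf_norm \<psi>) else 0)" for z \<psi>
  proof (cases "\<psi> \<in> Linf")
    case True
    then obtain K where "K \<ge> 0" "Linf_norm \<psi> = ereal K" "AE t in lebesgue. norm (\<psi> t) \<le> K"
      by (rule Linf_normE)
    then show ?thesis
      using norm_poisson_average_le[OF True] by (simp add: T_def)
  qed (simp add: T_def)
  obtain G \<Phi> where G: "G \<noteq> bot" "G \<le> F" and \<Phi>: "\<And>\<psi>. ((\<lambda>z. T z \<psi>) \<longlongrightarrow> \<Phi> \<psi>) G"
    using pointwise_limit_along_finer_filter[of F T, OF F(1) norm_T] by metis
  have pos: "\<forall>\<^sub>F z in G. Re z > 0"
    using filter_leD[OF G(2) F(2)] by (simp add: right_half_plane_def)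
  have ReG: "filterlim Re at_top G"
    using F(3) G(2) by (rule filterlim_mono[OF _ order_refl])
  have lim_avg: "((\<lambda>z. poisson_average z \<psi>) \<longlongrightarrow> \<Phi> \<psi>) G" if "\<psi> \<in> Linf" for \<psi>
    using \<Phi>[of \<psi>] by (rule Lim_transform_eventually) (use pos in eventually_elim, simp add: T_def that)
  \<comment> \<open>Uniqueness of limits: each identity for \<open>\<Phi>\<close> below reduces to a
    limit of Poisson averages along G.\<close>
  have eqI: "\<Phi> \<psi> = l" if "\<psi> \<in> Linf" "((\<lambda>z. poisson_average z \<psi>) \<longlongrightarrow> l) G" for \<psi> l
    using tendsto_unique[OF G(1) lim_avg[OF that(1)] that(2)] .
  have one: "(\<lambda>_. 1) \<in> Linf"
    by (rule LinfI[where K = 1]) auto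
  have "mean \<Phi>"
    unfolding mean_def Linf_dual_def mem_Collect_eq
  proof (intro conjI ballI allI impI exI)
    fix \<psi> \<eta> assume *: "\<psi> \<in> Linf" "\<eta> \<in> Linf"
    show "\<Phi> (\<lambda>y. \<psi> y + \<eta> y) = \<Phi> \<psi> + \<Phi> \<eta>"
    proof (rule eqI[OF Linf_add[OF *]])
      show "((\<lambda>z. poisson_average z (\<lambda>y. \<psi> y + \<eta> y)) \<longlongrightarrow> \<Phi> \<psi> + \<Phi> \<eta>) G"
        using tendsto_add[OF lim_avg[OF *(1)] lim_avg[OF *(2)]]
        by (rule Lim_transform_eventually) (use pos in eventually_elim, simp add: poisson_average_add *)
    qed
  next
    fix c \<psi> assume *: "\<psi> \<in> Linf"
    show "\<Phi> (\<lambda>y. c * \<psi> y) = c * \<Phi> \<psi>"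
      using tendsto_mult_left[OF lim_avg[OF *], of c]
      by (intro eqI[OF Linf_cmult[OF *]]) (simp add: poisson_average_cmult)
  next
    fix \<psi> assume *: "\<psi> \<in> Linf"
    have "norm (\<Phi> \<psi>) \<le> real_of_ereal (Linf_norm \<psi>)"
    proof (rule tendsto_upperbound[OF tendsto_norm[OF \<Phi>] _ G(1)])
      show "\<forall>\<^sub>F z in G. norm (T z \<psi>) \<le> real_of_ereal (Linf_norm \<psi>)"
        using norm_T[of _ \<psi>] * by (intro always_eventually) simp
    qed
    then show "norm (\<Phi> \<psi>) \<le> 1 * real_of_ereal (Linf_norm \<psi>)"
      by simp
  next
    fix \<psi> assume *: "\<psi> \<in> Linf" "AE y in lebesgue. \<psi> y \<in> \<real>\<^sub>\<ge>\<^sub>0"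
    show "\<Phi> \<psi> \<in> \<real>\<^sub>\<ge>\<^sub>0"
    proof (rule Lim_in_closed_set[OF closed_nonneg_Reals_complex _ G(1) lim_avg[OF *(1)]])
      show "\<forall>\<^sub>F z in G. poisson_average z \<psi> \<in> \<real>\<^sub>\<ge>\<^sub>0"
        using pos by eventually_elim (intro poisson_average_nonneg *)
    qed
  next
    have "\<forall>\<^sub>F z in G. 1 = poisson_average z (\<lambda>_. 1)"
      using pos by eventually_elim (simp add: poisson_average_one)
    then show "\<Phi> (\<lambda>_. 1) = 1"
      by (intro eqI[OF one] Lim_transform_eventually[OF tendsto_const])
  qed
  moreover have "\<Phi> (Defs.convolution f \<psi>) = \<Phi> \<psi>" if *: "f \<in> probability_densities" "\<psi> \<in> Linf" for f \<psi>
    using tendsto_add[OF poisson_average_convolution_tendsto[OF * ReG] lim_avg[OF *(2)]]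
    by (intro eqI[OF convolution_in_Linf[OF *]]) simp
  moreover have "\<Phi> (boundary_function \<phi>) = \<theta> \<phi>" if \<phi>: "\<phi> \<in> Hinf" for \<phi>
  proof (rule eqI[OF boundary_function_in_Linf[OF \<phi>]])
    \<comment> \<open>Weak* convergence is coordinatewise, so it can be read off at the single
      function \<open>\<phi>\<close>.\<close>
    have "((\<lambda>z. evaluation z \<phi>) \<longlongrightarrow> \<theta> \<phi>) F"
      using lim \<phi> by (simp add: weak_star_topology_def limitin_subtopology limitin_componentwise)
    then have "((\<lambda>z. evaluation z \<phi>) \<longlongrightarrow> \<theta> \<phi>) G"
      by (rule filterlim_mono[OF _ order_refl G(2)])
    then show "((\<lambda>z. poisson_average z (boundary_function \<phi>)) \<longlongrightarrow> \<theta> \<phi>) G"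
      by (rule Lim_transform_eventually)
        (use pos in eventually_elim, simp add: evaluation_def \<phi> poisson_average_boundary_function)
  qed
  ultimately show ?thesis
    unfolding topologically_invariant_mean_def by blast
qed

end
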